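(* Let $X\subset\mathbb{R}^d$ be a compact convex set, let $\rho$ be a probability measure supported on $X$ that is absolutely continuous with respect to the Lebesgue measure, with density (also denoted $\rho$) bounded from above and below on $X$ by positive constants, and let $Q\subset\mathbb{R}^d$ be a compact convex set. Then there exist constants $C_L,C_R>0$, depending only on $\rho$, $d$, $X$ and $Q$, such that for every integer $n\ge 1$ and every proper closed convex function $u:\mathbb{R}^d\to\mathbb{R}$ for which $\mu:=\mathrm{MA}_\rho(u^* )$ is a probability measure on $Q$, $$C_L\,\bigl(\operatorname{val}\mathcal{Q}_n^2(\mu)\bigr)^3\;\le\;\operatorname{val}(\mathcal{P}_n(u))\;\le\; C_R\,\bigl(\operatorname{val}\mathcal{Q}_n^1(\mu)\bigr)^{1/2}.$$
   Context: Legendre-Fenchel transform: $u^*(y)=\sup_{x\in\mathbb{R}^d}(y\cdot x-u(x))$ (possibly $+\infty$). $\rho$-Monge-Ampère measure: for a convex function $w$, $\mathrm{MA}_\rho(w)(E)=\rho(\partial w(E))$ for every Borel set $E\subseteq\mathbb{R}^d$, where $\partial w(E)=\bigcup_{x\in E}\partial w(x)$ and $\partial w(x)$ is the convex subdifferential. For $u$ as in the claim, $\mathrm{MA}_\rho(u^* )=(\nabla u)_\#\rho$. Polyhedral approximation problem $\mathcal{P}_n(u)$: $$\min_{(q_k,p_k)_{k=1}^n\in (Q\times\mathbb{R})^n}\Bigl(\int_X (u(x)-u_n(x))^2\,\rho(x)\,dx\Bigr)^{1/2}\quad\text{s.t. }\int_X (u(x)-u_n(x))\,\rho(x)\,dx=0,$$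 where $u_n(x)=\max_{k\in\{1,\dots,n\}}\langle q_k,x\rangle-p_k$. Quantization problem $\mathcal{Q}_n^p(\mu)$, for a probability measure $\mu$ on $Q$: $$\min_{\nu\in P(Q),\ |\mathrm{supp}(\nu)|\le n} W_p(\mu,\nu),$$ where $P(Q)$ is the set of probability measures on $Q$ and $W_p$ is the Wasserstein distance of order $p$, $W_p(\mu,\nu)=\bigl(\min_{\gamma\in\Gamma(\mu,\nu)}\int\|x-y\|_p^p\,d\gamma(x,y)\bigr)^{1/p}$, with $\Gamma(\mu,\nu)$ the set of probability measures on $\mathbb{R}^d\times\mathbb{R}^d$ with marginals $\mu$ and $\nu$. $\operatorname{val}$ denotes the optimal value of an optimization problem. *)

theory Defs
  imports "HOL-Probability.Probability"
begin

definition legendre_fenchel :: "(real^'d \<Rightarrow> real) \<Rightarrow> real^'d \<Rightarrow> ereal" where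
  "legendre_fenchel u y = (SUP x. ereal (y \<bullet> x - u x))"

definition subdifferential :: "(real^'d \<Rightarrow> ereal) \<Rightarrow> real^'d \<Rightarrow> (real^'d) set" where
  "subdifferential w x =
     {g. \<bar>w x\<bar> \<noteq> \<infinity> \<and> (\<forall>z. w x + ereal (g \<bullet> (z - x)) \<le> w z)}"

text \<open>The image of a Borel set under the subdifferential is Lebesgue measurable but need not be
  Borel, so \<open>R\<close> is evaluated on its completion. As usual with \<^const>\<open>measure_of\<close>, the result is the
  null measure should the set function fail to be countably additive.\<close>

definition monge_ampere :: "(real^'d) measure \<Rightarrow> (real^'d \<Rightarrow> ereal) \<Rightarrow> (real^'d) measure" where
  "monge_ampere R w =
     measure_of UNIV (sets borel) (\<lambda>E. emeasure (completion R) (\<Union>x\<in>E. subdifferential w x))"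

definition prob_measures_on :: "'a::topological_space set \<Rightarrow> 'a measure set" where
  "prob_measures_on S = {M. sets M = sets borel \<and> prob_space M \<and> emeasure M S = 1}"

definition measure_support :: "'a::topological_space measure \<Rightarrow> 'a set" where
  "measure_support M = {x. \<forall>U. open U \<and> x \<in> U \<longrightarrow> emeasure M U > 0}"

definition couplings ::
    "(real^'d) measure \<Rightarrow> (real^'d) measure \<Rightarrow> ((real^'d) \<times> (real^'d)) measure set" where
  "couplings M N =
     {G. sets G = sets borel \<and> prob_space G \<and> distr G borel fst = M \<and> distr G borel snd = N}"

text \<open>The cost is the \<open>p\<close>-th power of the \<open>\<ell>\<^sup>p\<close> norm. Conversion to a real number maps an infinite
  cost to \<open>0\<close>; this does not occur for probability measures on a bounded set.\<close>

definition wasserstein :: "real \<Rightarrow> (real^'d) measure \<Rightarrow> (real^'d) measure \<Rightarrow> real" where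
  "wasserstein p M N =
     enn2real (INF G\<in>couplings M N.
       \<integral>\<^sup>+ z. ennreal (\<Sum>i\<in>UNIV. \<bar>fst z $ i - snd z $ i\<bar> powr p) \<partial>G) powr (1 / p)"

text \<open>For \<open>n \<ge> 1\<close>, \<open>Q \<noteq> {}\<close> and a probability density \<open>\<rho>\<close> on \<open>X\<close>, the infima below range over nonempty
  sets of nonnegative reals, so \<^const>\<open>Inf\<close> is the optimal value.\<close>

definition val_quantization ::
    "nat \<Rightarrow> real \<Rightarrow> (real^'d) set \<Rightarrow> (real^'d) measure \<Rightarrow> real" where
  "val_quantization n p Q M =
     Inf {wasserstein p M N | N.
       N \<in> prob_measures_on Q \<and> finite (measure_support N) \<and> card (measure_support N) \<le> n}"

definition max_affine :: "nat \<Rightarrow> (nat \<Rightarrow> real^'d) \<Rightarrow> (nat \<Rightarrow> real) \<Rightarrow> real^'d \<Rightarrow> real" where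
  "max_affine n q p x = (MAX k\<in>{1..n}. q k \<bullet> x - p k)"

definition val_polyhedral ::
    "nat \<Rightarrow> (real^'d) set \<Rightarrow> (real^'d \<Rightarrow> real) \<Rightarrow> (real^'d) set \<Rightarrow> (real^'d \<Rightarrow> real) \<Rightarrow> real" where
  "val_polyhedral n X \<rho> Q u =
     Inf {sqrt (LINT x:X|lborel. (u x - max_affine n q p x)\<^sup>2 * \<rho> x) | q p.
       (\<forall>k\<in>{1..n}. q k \<in> Q) \<and> (LINT x:X|lborel. (u x - max_affine n q p x) * \<rho> x) = 0}"

end

theory Submission
  imports Defs
begin

text \<open>Write \<open>\<rho>\<close> also for the probability measure with density \<open>\<rho>\<close>. Subdifferentials of \<open>u\<close> and of its
conjugate are inverse to each other, so the Monge-Ampere measure of a set \<open>E\<close> is the mass of the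
points at which \<open>u\<close> has a subgradient in \<open>E\<close>. Being additive, it is the image of \<open>\<rho>\<close> under an almost
everywhere unique subgradient \<open>T\<close> of \<open>u\<close> (\<open>monge_ampere_eq_distr\<close>). After this reduction both
inequalities compare functions with their gradients.

Upper bound (\<open>val_polyhedral_le_wasserstein\<close>). Given a measure with at most \<open>n\<close> atoms in \<open>Q\<close>, let
\<open>v\<close> be the maximum of the affine functions that have these atoms as slopes and support \<open>u\<close> from below on
\<open>X\<close>. At a point \<open>x\<close> the gap \<open>u - v\<close> is nonnegative and at most a constant times the distance from
\<open>T x\<close> to the nearest atom. Integrating, its \<open>L\<^sup>1\<close> norm is at most a constant times the Wasserstein
distance of order one; since the gap is also bounded, its \<open>L\<^sup>2\<close> norm is at most the square root of
that, up to a constant. Shifting \<open>v\<close> to make the mean gap vanish only decreases the \<open>L\<^sup>2\<close> norm.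

Lower bound (\<open>val_quantization_cube_le\<close>). Given a maximum \<open>v\<close> of \<open>n\<close> affine functions with slopes in
\<open>Q\<close>, the image of \<open>\<rho>\<close> under the gradient of \<open>v\<close> has at most \<open>n\<close> atoms, and its Wasserstein
distance of order two from \<open>\<mu>\<close> is at most the \<open>L\<^sup>2\<close> distance of the gradients of \<open>u\<close> and \<open>v\<close>. It
remains to bound the cube of this distance by the \<open>L\<^sup>2\<close> distance of \<open>u\<close> and \<open>v\<close>. In one variable this
is an interpolation inequality (\<open>integral_square_subgradient_difference_le\<close>): for \<open>f = u - v\<close>,
integrating \<open>(f')\<^sup>2\<close> by parts and using that the derivatives of \<open>u\<close> and \<open>v\<close> are bounded and monotone
gives \<open>\<integral>(f')\<^sup>2 \<le> 8 L sup \<bar>f\<bar>\<close>, and for a Lipschitz function the supremum is bounded by the cube root of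
\<open>\<integral>f\<^sup>2\<close>. Its constant is the same for all intervals, so it can be applied to all segments that a
line parallel to a coordinate axis cuts out of \<open>X\<close>, and integrating over translates of such
segments (\<open>nn_integral_segment_average\<close>) gives the inequality on \<open>X\<close>. The bounds on the
density are used to pass between \<open>\<rho>\<close> and Lebesgue measure.\<close>

section \<open>Subgradients of convex functions of one variable\<close>

lemma subgradient_selection_mono:
  fixes g \<tau> :: "real \<Rightarrow> real"
  assumes "\<And>s t. s \<in> {a..b} \<Longrightarrow> t \<in> {a..b} \<Longrightarrow> g t + \<tau> t * (s - t) \<le> g s"
  shows "mono_on {a..b} \<tau>"
proof (rule mono_onI)
  fix s t assume st: "s \<in> {a..b}" "t \<in> {a..b}" "s \<le> t"
  have "(\<tau> t - \<tau> s) * (t - s) \<ge> 0"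
    using assms[of s t] assms[of t s] st by (simp add: algebra_simps)
  then show "\<tau> s \<le> \<tau> t"
    using st by (cases "s = t") (auto simp: zero_le_mult_iff)
qed

text \<open>A convex function is the integral of any selection of its subgradients. On an interval \<open>{c..d}\<close>
the increment of \<open>g\<close> and the integral of \<open>\<tau>\<close> both lie between \<open>\<tau> c * (d - c)\<close> and
\<open>\<tau> d * (d - c)\<close>; over a uniform partition of mesh \<open>h\<close> these errors telescope to
\<open>h * (\<tau> b - \<tau> a)\<close>, which is as small as desired.\<close>
lemma has_integral_subgradient_selection:
  fixes g \<tau> :: "real \<Rightarrow> real"
  assumes "a \<le> b"
    and sub: "\<And>s t. s \<in> {a..b} \<Longrightarrow> t \<in> {a..b} \<Longrightarrow> g t + \<tau> t * (s - t) \<le> g s"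
  shows "(\<tau> has_integral (g b - g a)) {a..b}"
proof -
  have mono: "mono_on {a..b} \<tau>"
    using subgradient_selection_mono[OF sub] by simp
  have int: "\<tau> integrable_on {a..b}"
    by (rule integrable_on_mono_on[OF mono])
  define E where "E t = g t - integral {a..t} \<tau>" for t
  have step: "\<bar>E d - E c\<bar> \<le> (\<tau> d - \<tau> c) * (d - c)"
    if cd: "c \<in> {a..b}" "d \<in> {a..b}" "c \<le> d" for c d
  proof -
    have intcd: "\<tau> integrable_on {c..d}"
      using integrable_subinterval_real[OF int] cd by auto
    have "integral {a..c} \<tau> + integral {c..d} \<tau> = integral {a..d} \<tau>"
      using cd by (intro Henstock_Kurzweil_Integration.integral_combine integrable_subinterval_real[OF int]) auto
    moreover have "\<tau> c * (d - c) \<le> integral {c..d} \<tau>"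
      using integral_le[OF integrable_const_ivl[of "\<tau> c" c d] intcd] mono cd
      by (auto simp: mono_on_def mult.commute)
    moreover have "integral {c..d} \<tau> \<le> \<tau> d * (d - c)"
      using integral_le[OF intcd integrable_const_ivl[of "\<tau> d" c d]] mono cd
      by (auto simp: mono_on_def mult.commute)
    moreover have "\<tau> c * (d - c) \<le> g d - g c" "g d - g c \<le> \<tau> d * (d - c)"
      using sub[of d c] sub[of c d] cd by (auto simp: algebra_simps)
    ultimately show ?thesis
      unfolding E_def by (auto simp: algebra_simps abs_le_iff)
  qed
  \<comment> \<open>Sum of the errors over \<open>Suc n\<close> intervals of equal length.\<close>
  have small: "\<bar>E b - E a\<bar> \<le> (b - a) * (\<tau> b - \<tau> a) / real (Suc n)" for n
  proof -
    define h where "h = (b - a) / real (Suc n)"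
    define x where "x i = a + real i * h" for i
    have h0: "h \<ge> 0" using assms by (simp add: h_def)
    have xn: "x (Suc n) = b" "x 0 = a" by (simp_all add: x_def h_def)
    have xm: "x i \<le> x j" if "i \<le> j" for i j
      using that h0 by (auto simp: x_def intro!: mult_right_mono)
    have xin: "x i \<in> {a..b}" if "i \<le> Suc n" for i
      using xm[of 0 i] xm[of i "Suc n"] that xn by auto
    have "\<bar>E b - E a\<bar> = \<bar>\<Sum>i<Suc n. E (x (Suc i)) - E (x i)\<bar>"
      using xn sum_lessThan_telescope[of "\<lambda>i. E (x i)" "Suc n"] by simp
    also have "\<dots> \<le> (\<Sum>i<Suc n. \<bar>E (x (Suc i)) - E (x i)\<bar>)" by (rule sum_abs)
    also have "\<dots> \<le> (\<Sum>i<Suc n. (\<tau> (x (Suc i)) - \<tau> (x i)) * h)"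
    proof (rule sum_mono)
      fix i assume "i \<in> {..<Suc n}"
      then show "\<bar>E (x (Suc i)) - E (x i)\<bar> \<le> (\<tau> (x (Suc i)) - \<tau> (x i)) * h"
        using step[of "x i" "x (Suc i)"] xin[of i] xin[of "Suc i"] xm[of i "Suc i"]
        by (auto simp: x_def algebra_simps)
    qed
    also have "\<dots> = (\<tau> b - \<tau> a) * h"
      using xn sum_lessThan_telescope[of "\<lambda>i. \<tau> (x i)" "Suc n"]
      by (simp only: sum_distrib_right[symmetric])
    finally show ?thesis by (simp add: h_def algebra_simps)
  qed
  have "(\<lambda>n. (b - a) * (\<tau> b - \<tau> a) / real (Suc n)) \<longlonglongrightarrow> 0"
    by (rule LIMSEQ_Suc[OF lim_const_over_n])
  then have "\<bar>E b - E a\<bar> \<le> 0"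
    using small by (intro LIMSEQ_le_const) auto
  then have "integral {a..b} \<tau> = g b - g a" by (simp add: E_def)
  then show ?thesis using int by (metis integrable_integral)
qed

text \<open>Two selections can differ only where the monotone function \<open>\<tau>\<close> jumps, hence on a countable set.
This makes it harmless to replace a selection that is a subgradient only almost everywhere by one
that is a subgradient everywhere.\<close>
lemma subgradient_selection_ae_unique:
  fixes g \<tau> T :: "real \<Rightarrow> real"
  assumes sub: "\<And>s t. s \<in> {a..b} \<Longrightarrow> t \<in> {a..b} \<Longrightarrow> g t + \<tau> t * (s - t) \<le> g s"
    and T: "AE t in lborel. t \<in> {a..b} \<longrightarrow> (\<forall>s\<in>{a..b}. g t + T t * (s - t) \<le> g s)"
  shows "AE t in lborel. t \<in> {a..b} \<longrightarrow> T t = \<tau> t"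
proof -
  let ?D = "{t\<in>{a..b}. \<not> continuous (at t within {a..b}) \<tau>}"
  have "countable (?D \<union> {a, b})"
    using mono_on_ctble_discont[OF subgradient_selection_mono[OF sub]] by auto
  then have "AE t in lborel. t \<notin> ?D \<union> {a, b}"
    using countable_imp_null_set_lborel AE_not_in by blast
  then show ?thesis using T
  proof eventually_elim
    fix t
    assume t: "t \<notin> ?D \<union> {a, b}" and Tt: "t \<in> {a..b} \<longrightarrow> (\<forall>s\<in>{a..b}. g t + T t * (s - t) \<le> g s)"
    show "t \<in> {a..b} \<longrightarrow> T t = \<tau> t"
    proof
      assume tab: "t \<in> {a..b}"
      then have ab: "a < t" "t < b" and "continuous (at t within {a..b}) \<tau>"
        using t by auto
      then have "isCont \<tau> t"
        by (simp only: at_within_Icc_at)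
      then have lim: "(\<tau> \<longlongrightarrow> \<tau> t) (at t)" by (simp add: isCont_def)
      \<comment> \<open>Monotonicity of the subdifferential squeezes every subgradient at \<open>t\<close> between the
        one-sided limits of \<open>\<tau>\<close>.\<close>
      have cmp: "(\<tau> s - T t) * (s - t) \<ge> 0" if "s \<in> {a..b}" for s
        using Tt[rule_format, OF tab that] sub[OF tab that] by (simp add: algebra_simps)
      have right: "T t \<le> \<tau> s" if "t < s" "s < b" for s
        using cmp[of s] that ab by (auto simp: zero_le_mult_iff)
      have left: "\<tau> s \<le> T t" if "a < s" "s < t" for s
        using cmp[of s] that ab by (auto simp: zero_le_mult_iff)
      have "\<tau> t \<ge> T t"
      proof (rule tendsto_lowerbound)
        show "(\<tau> \<longlongrightarrow> \<tau> t) (at_right t)" using lim by (rule filterlim_at_split[THEN iffD1, THEN conjunct2])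
        show "\<forall>\<^sub>F s in at_right t. T t \<le> \<tau> s"
          unfolding eventually_at_right_field using ab right
          by (intro exI[of _ b]) auto
      qed simp
      moreover have "\<tau> t \<le> T t"
      proof (rule tendsto_upperbound)
        show "(\<tau> \<longlongrightarrow> \<tau> t) (at_left t)" using lim by (rule filterlim_at_split[THEN iffD1, THEN conjunct1])
        show "\<forall>\<^sub>F s in at_left t. \<tau> s \<le> T t"
          unfolding eventually_at_left_field using ab left
          by (intro exI[of _ a]) auto
      qed simp
      ultimately show "T t = \<tau> t" by simp
    qed
  qed
qed

text \<open>This stands in for integrating by parts against the measure \<open>d\<tau>\<close>, whose mass is at most
\<open>2 * L\<close>: the second mean value theorem rewrites the integral of \<open>\<tau>\<close> times the derivative of \<open>f\<close>
as a combination of values of \<open>f\<close>, so only the supremum of \<open>f\<close> enters, not that of its derivative.\<close>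
lemma abs_integral_mono_times_derivative_le:
  fixes \<tau> d :: "real \<Rightarrow> real"
  assumes "a \<le> b" and mono: "mono_on {a..b} \<tau>" and bound: "\<And>t. t \<in> {a..b} \<Longrightarrow> \<bar>\<tau> t\<bar> \<le> L"
    and d: "\<And>c e. a \<le> c \<Longrightarrow> c \<le> e \<Longrightarrow> e \<le> b \<Longrightarrow> (d has_integral (f e - f c)) {c..e}"
    and M: "\<And>t. t \<in> {a..b} \<Longrightarrow> \<bar>f t\<bar> \<le> M"
  shows "\<exists>I. ((\<lambda>t. \<tau> t * d t) has_integral I) {a..b} \<and> \<bar>I\<bar> \<le> 4 * L * M"
proof -
  have "d integrable_on {a..b}" using d[of a b] assms(1) by auto
  then obtain c where c: "c \<in> {a..b}" and
    I: "((\<lambda>t. \<tau> t * d t) has_integral (\<tau> a * integral {a..c} d + \<tau> b * integral {c..b} d)) {a..b}"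
    using second_mean_value_theorem_full[of d a b \<tau>] assms(1) mono by (auto simp: mono_on_def)
  have L0: "0 \<le> L" using bound[of a] assms(1) by auto
  have d_eq: "integral {a..c} d = f c - f a" "integral {c..b} d = f b - f c"
    using d[of a c] d[of c b] c by (auto intro: integral_unique)
  have "\<bar>\<tau> a * (f c - f a)\<bar> \<le> L * (2 * M)" "\<bar>\<tau> b * (f b - f c)\<bar> \<le> L * (2 * M)"
    unfolding abs_mult
    using L0 bound[of a] bound[of b] M[of a] M[of b] M[OF c] assms(1) by (auto intro!: mult_mono)
  then have "\<bar>\<tau> a * integral {a..c} d + \<tau> b * integral {c..b} d\<bar> \<le> 4 * L * M"
    unfolding d_eq by linarith
  then show ?thesis using I by blast
qed

text \<open>The interpolation inequality behind the lower bound. With \<open>f = g - k\<close>, writing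
\<open>(f')\<^sup>2 = \<tau> f' - \<sigma> f'\<close> and applying the previous bound twice gives \<open>\<integral>(f')\<^sup>2 \<le> 8 L sup \<bar>f\<bar>\<close>. As \<open>f\<close> is
\<open>2 L\<close>-Lipschitz, its supremum is controlled by the cube root of \<open>\<integral>f\<^sup>2\<close>, unless the interval is so short
that the trivial bound \<open>\<bar>f'\<bar> \<le> 2 L\<close> suffices. The cube root is written as the minimum over
\<open>\<delta>\<close> of \<open>A / \<delta>\<^sup>2 + \<delta>\<close>: in this form the inequality is linear in \<open>A\<close> and can be integrated over
parallel lines. The constants do not depend on the length of the interval, which matters because
lines can meet a convex set in arbitrarily short segments.\<close>
lemma integral_square_subgradient_difference_le:
  fixes g k \<tau> \<sigma> :: "real \<Rightarrow> real"
  assumes ab: "a \<le> b" and L: "0 < L" and lam: "0 < \<delta>"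
    and g: "\<And>s t. s \<in> {a..b} \<Longrightarrow> t \<in> {a..b} \<Longrightarrow> g t + \<tau> t * (s - t) \<le> g s"
    and k: "\<And>s t. s \<in> {a..b} \<Longrightarrow> t \<in> {a..b} \<Longrightarrow> k t + \<sigma> t * (s - t) \<le> k s"
    and bd: "\<And>t. t \<in> {a..b} \<Longrightarrow> \<bar>\<tau> t\<bar> \<le> L" "\<And>t. t \<in> {a..b} \<Longrightarrow> \<bar>\<sigma> t\<bar> \<le> L"
  shows "\<exists>I A. ((\<lambda>t. (\<tau> t - \<sigma> t)\<^sup>2) has_integral I) {a..b} \<and>
     ((\<lambda>t. (g t - k t)\<^sup>2) has_integral A) {a..b} \<and> I \<le> (128 * L\<^sup>2 + 8 * L) * (A / \<delta>\<^sup>2 + \<delta>)"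
proof -
  define f where "f t = g t - k t" for t
  define d where "d t = \<tau> t - \<sigma> t" for t
  have lip: "\<bar>f s - f t\<bar> \<le> 2 * L * \<bar>s - t\<bar>" if "s \<in> {a..b}" "t \<in> {a..b}" for s t
  proof -
    have *: "\<bar>h s - h t\<bar> \<le> L * \<bar>s - t\<bar>"
      if h: "\<And>s t. s \<in> {a..b} \<Longrightarrow> t \<in> {a..b} \<Longrightarrow> h t + \<eta> t * (s - t) \<le> h s"
        and e: "\<And>t. t \<in> {a..b} \<Longrightarrow> \<bar>\<eta> t\<bar> \<le> L" for h \<eta> :: "real \<Rightarrow> real"
    proof -
      have "\<bar>\<eta> t * (s - t)\<bar> \<le> L * \<bar>s - t\<bar>" "\<bar>\<eta> s * (t - s)\<bar> \<le> L * \<bar>s - t\<bar>"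
        unfolding abs_mult abs_minus_commute[of t s] using e \<open>s \<in> {a..b}\<close> \<open>t \<in> {a..b}\<close>
        by (auto intro!: mult_right_mono)
      then show ?thesis
        using h[of s t] h[of t s] \<open>s \<in> {a..b}\<close> \<open>t \<in> {a..b}\<close> by linarith
    qed
    show ?thesis using *[OF g bd(1)] *[OF k bd(2)] unfolding f_def by (auto simp: abs_le_iff)
  qed
  have cont: "continuous_on {a..b} f"
  proof (rule continuous_on_iff[THEN iffD2], intro ballI allI impI)
    fix x and e :: real assume x: "x \<in> {a..b}" and e: "0 < e"
    show "\<exists>\<delta>>0. \<forall>y\<in>{a..b}. dist y x < \<delta> \<longrightarrow> dist (f y) (f x) < e"
      using lip[OF _ x] L e
      by (intro exI[of _ "e / (2 * L)"]) (fastforce simp: dist_real_def field_simps)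
  qed
  obtain x0 where x0: "x0 \<in> {a..b}" and x0max: "\<And>t. t \<in> {a..b} \<Longrightarrow> \<bar>f t\<bar> \<le> \<bar>f x0\<bar>"
    using continuous_attains_sup[of "{a..b}" "\<lambda>t. \<bar>f t\<bar>"] continuous_on_rabs[OF cont] ab
    by (metis atLeastatMost_empty_iff2 compact_Icc leD)
  define M where "M = \<bar>f x0\<bar>"
  have M: "\<bar>f t\<bar> \<le> M" if "t \<in> {a..b}" for t using x0max that by (simp add: M_def)
  have M0: "0 \<le> M" by (simp add: M_def)
  have dint: "(d has_integral (f e - f c)) {c..e}" if "a \<le> c" "c \<le> e" "e \<le> b" for c e
  proof -
    have "(\<tau> has_integral g e - g c) {c..e}" "(\<sigma> has_integral k e - k c) {c..e}"
      using that g k by (auto intro!: has_integral_subgradient_selection)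
    from has_integral_diff[OF this] show ?thesis unfolding d_def f_def by (simp add: algebra_simps)
  qed
  obtain I1 where I1: "((\<lambda>t. \<tau> t * d t) has_integral I1) {a..b}" "\<bar>I1\<bar> \<le> 4 * L * M"
    using abs_integral_mono_times_derivative_le[OF ab subgradient_selection_mono[OF g] bd(1) dint M] by blast
  obtain I2 where I2: "((\<lambda>t. \<sigma> t * d t) has_integral I2) {a..b}" "\<bar>I2\<bar> \<le> 4 * L * M"
    using abs_integral_mono_times_derivative_le[OF ab subgradient_selection_mono[OF k] bd(2) dint M] by blast
  define I where "I = I1 - I2"
  have I: "((\<lambda>t. (\<tau> t - \<sigma> t)\<^sup>2) has_integral I) {a..b}"
    using has_integral_diff[OF I1(1) I2(1)]
    by (simp add: I_def d_def power2_eq_square algebra_simps)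
  have I8: "I \<le> 8 * L * M" using I1 I2 unfolding I_def by linarith
  define A where "A = integral {a..b} (\<lambda>t. (f t)\<^sup>2)"
  have fint: "(\<lambda>t. (f t)\<^sup>2) integrable_on {a..b}"
    by (intro integrable_continuous_interval continuous_intros cont)
  have A: "((\<lambda>t. (g t - k t)\<^sup>2) has_integral A) {a..b}"
    using fint unfolding A_def f_def by (rule integrable_integral)
  have A0: "0 \<le> A" unfolding A_def by (rule Henstock_Kurzweil_Integration.integral_nonneg[OF fint]) simp
  let ?C = "128 * L\<^sup>2 + 8 * L"
  have "I \<le> ?C * (A / \<delta>\<^sup>2 + \<delta>)"
  proof (cases "b - a \<le> \<delta> / L")
    case True
    have "I \<le> 4 * L\<^sup>2 * (b - a)"
    proof (rule has_integral_le[OF I])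
      show "((\<lambda>t. 4 * L\<^sup>2) has_integral 4 * L\<^sup>2 * (b - a)) {a..b}"
        using has_integral_const_real[of "4 * L\<^sup>2" a b] ab by (simp add: mult.commute)
      fix t assume "t \<in> {a..b}"
      then have "\<bar>\<tau> t - \<sigma> t\<bar> \<le> 2 * L" using bd[of t] by linarith
      then have "\<bar>\<tau> t - \<sigma> t\<bar>\<^sup>2 \<le> (2 * L)\<^sup>2" by (intro power_mono) auto
      then show "(\<tau> t - \<sigma> t)\<^sup>2 \<le> 4 * L\<^sup>2" by (simp add: power_mult_distrib)
    qed
    also have "\<dots> \<le> 4 * L\<^sup>2 * (\<delta> / L)" using True by (intro mult_left_mono) auto
    also have "\<dots> = 4 * L * \<delta>" using L by (simp add: power2_eq_square)
    also have "\<dots> \<le> ?C * \<delta>" using L lam by (intro mult_right_mono) auto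
    also have "\<dots> \<le> ?C * (A / \<delta>\<^sup>2 + \<delta>)" using L A0 by (intro mult_left_mono) auto
    finally show ?thesis .
  next
    case long: False
    show ?thesis
    proof (cases "M \<le> \<delta>")
      case True
      have "I \<le> 8 * L * \<delta>" using order_trans[OF I8 mult_left_mono[OF True, of "8 * L"]] L by simp
      also have "\<dots> \<le> ?C * \<delta>" using L lam by (intro mult_right_mono) auto
      also have "\<dots> \<le> ?C * (A / \<delta>\<^sup>2 + \<delta>)" using L A0 by (intro mult_left_mono) auto
      finally show ?thesis .
    next
      case False
      \<comment> \<open>Being \<open>2 L\<close>-Lipschitz, \<open>\<bar>f\<bar>\<close> stays above \<open>M / 2\<close> on an interval of length \<open>\<delta> / (4 L)\<close> with
        endpoint \<open>x0\<close>, and one of the two such intervals lies in \<open>{a..b}\<close>.\<close>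
      define s where "s = \<delta> / (4 * L)"
      have s0: "0 < s" using L lam by (simp add: s_def)
      have sl: "4 * s < b - a" using long L by (simp add: s_def)
      obtain c where c: "a \<le> c" "c + s \<le> b" "c \<le> x0" "x0 \<le> c + s"
      proof (cases "x0 + s \<le> b")
        case True then show ?thesis using that[of x0] x0 s0 by auto
      next
        case False then show ?thesis using that[of "x0 - s"] x0 s0 sl by auto
      qed
      have low: "M / 2 \<le> \<bar>f t\<bar>" if "t \<in> {c..c + s}" for t
      proof -
        have "\<bar>f x0 - f t\<bar> \<le> 2 * L * \<bar>x0 - t\<bar>" using lip[of x0 t] x0 c that by auto
        also have "\<dots> \<le> 2 * L * s" using L c that by (intro mult_left_mono) auto
        also have "\<dots> = \<delta> / 2" using L by (simp add: s_def)
        finally show ?thesis using False unfolding M_def by linarith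
      qed
      have "(M / 2)\<^sup>2 * s \<le> integral {c..c + s} (\<lambda>t. (f t)\<^sup>2)"
      proof -
        have i: "(\<lambda>t. (f t)\<^sup>2) integrable_on {c..c + s}"
          using integrable_subinterval_real[OF fint] c by auto
        have "(M / 2)\<^sup>2 \<le> (f t)\<^sup>2" if "t \<in> {c..c + s}" for t
          using power_mono[OF low[OF that], of 2] M0 by simp
        then show ?thesis
          using integral_le[OF integrable_const_ivl[of "(M / 2)\<^sup>2" c "c + s"] i] s0
          by (simp add: mult.commute)
      qed
      also have "\<dots> \<le> A" unfolding A_def
        using c fint by (intro integral_subset_le) (auto intro: integrable_subinterval_real[OF fint])
      finally have low_A: "M\<^sup>2 * \<delta> \<le> 16 * L * A" using L by (simp add: s_def field_simps power2_eq_square)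
      have "M * \<delta>\<^sup>2 \<le> M\<^sup>2 * \<delta>"
        using False lam M0 by (simp add: power2_eq_square mult_left_mono)
      then have "M * \<delta>\<^sup>2 \<le> 16 * L * A" using low_A by linarith
      then have "M \<le> 16 * L * (A / \<delta>\<^sup>2)" using lam by (simp add: field_simps)
      then have "8 * L * M \<le> 8 * L * (16 * L * (A / \<delta>\<^sup>2))" using L by (intro mult_left_mono) auto
      then have "I \<le> 8 * L * (16 * L * (A / \<delta>\<^sup>2))" using I8 by linarith
      also have "\<dots> = 128 * L\<^sup>2 * (A / \<delta>\<^sup>2)" by (simp add: power2_eq_square)
      also have "\<dots> \<le> ?C * (A / \<delta>\<^sup>2)" using L A0 by (intro mult_right_mono) auto
      also have "\<dots> \<le> ?C * (A / \<delta>\<^sup>2 + \<delta>)" using L lam by (intro mult_left_mono) auto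
      finally show ?thesis .
    qed
  qed
  then show ?thesis using I A by blast
qed

section \<open>Subdifferentials and the Legendre-Fenchel transform\<close>

definition subgradients :: "('a::real_inner \<Rightarrow> real) \<Rightarrow> 'a \<Rightarrow> 'a set" where
  "subgradients u x = {y. \<forall>z. u x + y \<bullet> (z - x) \<le> u z}"

text \<open>A hyperplane separating the open vertical half-line below \<open>(x, u x)\<close> from the epigraph cannot be
vertical, because \<open>u\<close> is finite everywhere; its slope is a subgradient.\<close>
lemma subgradients_nonempty:
  fixes u :: "'a::euclidean_space \<Rightarrow> real"
  assumes "convex_on UNIV u"
  shows "subgradients u x \<noteq> {}"
proof -
  let ?S = "{x} \<times> {..<u x}"
  have "\<exists>a b. a \<noteq> 0 \<and> (\<forall>p\<in>?S. a \<bullet> p \<le> b) \<and> (\<forall>p\<in>epigraph UNIV u. a \<bullet> p \<ge> b)"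
  proof (rule separating_hyperplane_sets)
    show "convex ?S" by (intro convex_Times) auto
    show "convex (epigraph UNIV u)" using assms by (simp add: convex_epigraph)
    show "?S \<noteq> {}" using lt_ex by auto
    show "epigraph UNIV u \<noteq> {}" by (auto simp: epigraph_def)
    show "?S \<inter> epigraph UNIV u = {}" by (auto simp: epigraph_def)
  qed
  then obtain p b where p: "p \<noteq> 0" and bS: "\<forall>q\<in>?S. p \<bullet> q \<le> b"
    and bE: "\<forall>q\<in>epigraph UNIV u. b \<le> p \<bullet> q" by blast
  obtain \<alpha> \<beta> where ab: "p = (\<alpha>, \<beta>)" by (cases p)
  have lo: "\<alpha> \<bullet> x + \<beta> * r \<le> b" if "r < u x" for r using bS that by (auto simp: ab)
  have hi: "b \<le> \<alpha> \<bullet> z + \<beta> * u z" for z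
    using bE by (auto simp: ab epigraph_def)
  have \<beta>0: "0 \<le> \<beta>"
  proof -
    have "\<alpha> \<bullet> x + \<beta> * (u x - 1) \<le> \<alpha> \<bullet> x + \<beta> * u x"
      using lo[of "u x - 1"] hi[of x] by linarith
    then show ?thesis by (simp add: algebra_simps)
  qed
  have lim: "\<alpha> \<bullet> x + \<beta> * u x \<le> b"
  proof (rule field_le_epsilon)
    fix e :: real assume e: "0 < e"
    have "\<beta> * (e / (\<beta> + 1)) \<le> e" using e \<beta>0 by (simp add: field_simps)
    then show "\<alpha> \<bullet> x + \<beta> * u x \<le> b + e"
      using lo[of "u x - e / (\<beta> + 1)"] e \<beta>0 by (auto simp: algebra_simps)
  qed
  have key: "\<alpha> \<bullet> x + \<beta> * u x \<le> \<alpha> \<bullet> z + \<beta> * u z" for z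
    using lim hi[of z] by linarith
  have "\<beta> \<noteq> 0"
  proof
    assume "\<beta> = 0"
    then have "\<alpha> \<bullet> \<alpha> \<le> 0" using key[of "x - \<alpha>"] by (simp add: inner_diff_right)
    then have "\<alpha> = 0" by (metis inner_ge_zero inner_eq_zero_iff order_antisym)
    then show False using p ab \<open>\<beta> = 0\<close> by (simp add: zero_prod_def)
  qed
  with \<beta>0 have \<beta>: "0 < \<beta>" by simp
  have "u x + (- \<alpha> /\<^sub>R \<beta>) \<bullet> (z - x) \<le> u z" for z
    using key[of z] \<beta> by (simp add: inner_diff_right field_simps)
  then have "- \<alpha> /\<^sub>R \<beta> \<in> subgradients u x" by (simp add: subgradients_def)
  then show ?thesis by blast
qed

lemma legendre_fenchel_at_subgradient:
  assumes "y \<in> subgradients u x"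
  shows "legendre_fenchel u y = ereal (y \<bullet> x - u x)"
  unfolding legendre_fenchel_def
proof (rule antisym)
  show "(SUP z. ereal (y \<bullet> z - u z)) \<le> ereal (y \<bullet> x - u x)"
    using assms by (intro SUP_least) (auto simp: subgradients_def inner_diff_right algebra_simps)
qed (rule SUP_upper, simp)

text \<open>For the direction from left to right, testing the subgradient inequality of the
transform at a subgradient \<open>g\<close> of \<open>u\<close> at \<open>x\<close>, where the value of the transform is known, shows
that the supremum in the transform at \<open>y\<close> is attained at \<open>x\<close>.\<close>
lemma subdifferential_legendre_fenchel_iff:
  fixes u :: "real^'d \<Rightarrow> real"
  assumes "convex_on UNIV u"
  shows "x \<in> subdifferential (legendre_fenchel u) y \<longleftrightarrow> y \<in> subgradients u x"
proof
  assume y: "y \<in> subgradients u x"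
  show "x \<in> subdifferential (legendre_fenchel u) y"
    unfolding subdifferential_def
  proof (intro CollectI conjI allI)
    fix z
    have "ereal (z \<bullet> x - u x) \<le> legendre_fenchel u z"
      unfolding legendre_fenchel_def by (rule SUP_upper) simp
    then show "legendre_fenchel u y + ereal (x \<bullet> (z - y)) \<le> legendre_fenchel u z"
      by (simp add: legendre_fenchel_at_subgradient[OF y] inner_diff_right inner_commute[of x])
  qed (simp add: legendre_fenchel_at_subgradient[OF y])
next
  assume "x \<in> subdifferential (legendre_fenchel u) y"
  then obtain c where c: "legendre_fenchel u y = ereal c"
    and sub: "\<And>z. ereal c + ereal (x \<bullet> (z - y)) \<le> legendre_fenchel u z"
    by (cases "legendre_fenchel u y") (auto simp: subdifferential_def)
  obtain g where g: "g \<in> subgradients u x" using subgradients_nonempty[OF assms] by blast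
  have "c + x \<bullet> (g - y) \<le> g \<bullet> x - u x"
    using sub[of g] by (simp add: legendre_fenchel_at_subgradient[OF g])
  then have "c \<le> y \<bullet> x - u x" by (simp add: inner_diff_right inner_commute[of x])
  moreover have "y \<bullet> z - u z \<le> c" for z
  proof -
    have "ereal (y \<bullet> z - u z) \<le> legendre_fenchel u y"
      unfolding legendre_fenchel_def by (rule SUP_upper) simp
    then show ?thesis by (simp add: c)
  qed
  ultimately have "y \<bullet> z - u z \<le> y \<bullet> x - u x" for z by (metis order_trans)
  then show "y \<in> subgradients u x"
    by (simp add: subgradients_def inner_diff_right algebra_simps)
qed

lemma continuous_on_convex_UNIV:
  fixes u :: "'a::euclidean_space \<Rightarrow> real"
  assumes "convex_on UNIV u" shows "continuous_on S u"
  using convex_on_continuous[OF open_UNIV assms] continuous_on_subset by blast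

text \<open>The graph of the subdifferential is closed, and projecting along the compact set \<open>K\<close> keeps it
closed. In particular these sets are Borel, so that on compact sets the Monge-Ampere measure is
given by \<open>R\<close> itself rather than by its completion.\<close>
lemma closed_subgradient_preimage:
  fixes u :: "'a::euclidean_space \<Rightarrow> real"
  assumes u: "convex_on UNIV u" and "compact K"
  shows "closed {x. \<exists>y\<in>K. y \<in> subgradients u x}"
proof -
  have "closed {p. snd p \<in> UNIV \<and> fst p \<in> subgradients u (snd p)}"
    unfolding subgradients_def
    by (auto intro!: closed_Collect_all closed_Collect_le continuous_intros
        continuous_on_compose2[OF continuous_on_convex_UNIV[OF u, of UNIV]])
  from closed_compact_projection[OF \<open>compact K\<close> this] show ?thesis
    by (simp add: Bex_def)
qed

section \<open>The Monge-Ampere measure as an image measure\<close>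

text \<open>A Monge-Ampere measure that does not vanish identically cannot be the null measure returned by
\<open>measure_of\<close> for set functions that fail to be countably additive, hence it agrees with the set
function that defines it.\<close>
lemma emeasure_monge_ampere_compact:
  fixes u :: "real^'d \<Rightarrow> real"
  assumes u: "convex_on UNIV u" and R: "sets R = sets borel"
    and nontriv: "emeasure (monge_ampere R (legendre_fenchel u)) Q \<noteq> 0" and K: "compact K"
  shows "emeasure (monge_ampere R (legendre_fenchel u)) K
    = emeasure R {x. \<exists>y\<in>K. y \<in> subgradients u x}"
proof -
  let ?m = "\<lambda>E. emeasure (completion R) (\<Union>x\<in>E. subdifferential (legendre_fenchel u) x)"
  have "sigma_sets UNIV (sets borel) = sets (borel :: (real^'d) measure)"
    by (metis sets.sigma_sets_eq space_borel)
  then have "emeasure (monge_ampere R (legendre_fenchel u)) K = ?m K"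
    using nontriv K unfolding monge_ampere_def emeasure_measure_of_conv
    by (auto split: if_splits simp: borel_closed compact_imp_closed)
  also have "(\<Union>x\<in>K. subdifferential (legendre_fenchel u) x) = {x. \<exists>y\<in>K. y \<in> subgradients u x}"
    using subdifferential_legendre_fenchel_iff[OF u] by blast
  also have "emeasure (completion R) \<dots> = emeasure R \<dots>"
    using closed_subgradient_preimage[OF u K] R
    by (simp add: borel_closed)
  finally show ?thesis .
qed

lemma separating_halfspaces:
  fixes y z :: "real^'d"
  assumes "y \<noteq> z"
  shows "\<exists>i. \<exists>r\<in>\<rat>. \<exists>s\<in>\<rat>. r < s \<and> (y$i \<le> r \<and> s \<le> z$i \<or> z$i \<le> r \<and> s \<le> y$i)"
proof -
  obtain i where i: "y$i \<noteq> z$i" using assms by (auto simp: vec_eq_iff)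
  have *: "\<exists>r\<in>\<rat>. \<exists>s\<in>\<rat>. r < s \<and> a \<le> r \<and> s \<le> b" if ab: "a < b" for a b :: real
  proof -
    obtain r where r: "r \<in> \<rat>" "a < r" "r < b" using Rats_dense_in_real[OF ab] by blast
    obtain s where s: "s \<in> \<rat>" "r < s" "s < b" using Rats_dense_in_real[OF r(3)] by blast
    show ?thesis using r s by (intro bexI[of _ r] bexI[of _ s]) auto
  qed
  from i consider "y$i < z$i" | "z$i < y$i" by linarith
  then show ?thesis
  proof cases
    case 1 with *[OF 1] show ?thesis by blast
  next
    case 2 with *[OF 2] show ?thesis by blast
  qed
qed

lemma borel_measure_eqI_closed:
  fixes M N :: "'a::topological_space measure"
  assumes "sets M = sets borel" "sets N = sets borel" and "finite_measure M"
    and "\<And>C. closed C \<Longrightarrow> emeasure M C = emeasure N C"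
  shows "M = N"
proof (rule measure_eqI_generator_eq[where E = "Collect closed" and \<Omega> = UNIV and A = "\<lambda>_. UNIV"])
  show "Int_stable {S::'a set. closed S}" by (auto simp: Int_stable_def)
  show "sets M = sigma_sets UNIV (Collect closed)" "sets N = sigma_sets UNIV (Collect closed)"
    using assms by (simp_all add: borel_eq_closed)
  show "emeasure M UNIV \<noteq> \<infinity>"
    using finite_measure.emeasure_finite[OF assms(3)] by auto
qed (use assms in auto)

text \<open>The map \<open>T\<close> is the gradient of \<open>u\<close>; that it is determined almost everywhere follows from
the additivity of \<open>\<mu>\<close>. If \<open>E\<close> and \<open>F\<close> are disjoint compact sets, additivity forces the points
having subgradients in both to form a null set. Letting \<open>E\<close> and \<open>F\<close> run through countably many
pairs of parts of \<open>Q\<close> cut out by rational half-spaces, which separate any two points of \<open>Q\<close>, leaves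
exactly one subgradient in \<open>Q\<close> at almost every point. Preimages of closed sets under the resulting
map are preimages under the subdifferential up to a null set, which gives both measurability and the
identification of \<open>\<mu>\<close>.\<close>
lemma monge_ampere_eq_distr:
  fixes u :: "real^'d \<Rightarrow> real"
  assumes u: "convex_on UNIV u" and R: "prob_space R" "sets R = sets borel"
    and \<mu>: "\<mu> = monge_ampere R (legendre_fenchel u)" "\<mu> \<in> prob_measures_on Q" and Q: "compact Q"
  obtains T where "T \<in> borel_measurable borel" "range T \<subseteq> Q"
    "AE x in R. T x \<in> subgradients u x" "\<mu> = distr R borel T"
proof -
  interpret R: prob_space R by fact
  define P where "P K = {x. \<exists>y\<in>K. y \<in> subgradients u x}" for K
  have \<mu>p: "sets \<mu> = sets borel" "prob_space \<mu>" "emeasure \<mu> Q = 1"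
    using \<mu>(2) by (auto simp: prob_measures_on_def)
  interpret \<mu>: prob_space \<mu> by fact
  have [measurable]: "Q \<in> sets borel" using Q by (simp add: borel_closed compact_imp_closed)
  have \<mu>K: "emeasure \<mu> K = emeasure R (P K)" if "compact K" for K
    using emeasure_monge_ampere_compact[OF u R(2) _ that, of Q] \<mu>p(3) unfolding \<mu>(1) P_def by simp
  have closedP: "closed (P K)" if "compact K" for K
    unfolding P_def by (rule closed_subgradient_preimage[OF u that])
  have P[measurable]: "P K \<in> sets R" if "compact K" for K
    using closedP[OF that] R(2) by (simp add: borel_closed)
  have spR: "space R = UNIV" using R(2) by (metis sets_eq_imp_space_eq space_borel)
  have sp\<mu>: "space \<mu> = UNIV" using \<mu>p(1) by (metis sets_eq_imp_space_eq space_borel)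
  \<comment> \<open>Additivity of \<open>\<mu>\<close> on disjoint compact sets is where almost everywhere uniqueness of
    subgradients comes from.\<close>
  have null: "P E \<inter> P F \<in> null_sets R" if EF: "compact E" "compact F" "E \<inter> F = {}" for E F
  proof -
    have "P (E \<union> F) = P E \<union> P F" by (auto simp: P_def)
    then have "measure R (P E \<union> P F) = measure \<mu> (E \<union> F)"
      using \<mu>K[of "E \<union> F"] EF by (simp add: measure_def compact_Un)
    also have "\<dots> = measure \<mu> E + measure \<mu> F"
      using EF \<mu>p(1) by (intro \<mu>.finite_measure_Union) (auto simp: borel_closed compact_imp_closed)
    also have "\<dots> = measure R (P E) + measure R (P F)"
      using \<mu>K EF by (simp add: measure_def)
    also have "measure R (P E) = measure R (P E - P F) + measure R (P E \<inter> P F)"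
      using P EF R.finite_measure_Diff'[of "P E" "P F"] by simp
    moreover have "measure R (P E \<union> P F) = measure R (P E - P F) + measure R (P F)"
      using P EF R.finite_measure_Union'[of "P F" "P E"] by (simp add: Un_commute)
    ultimately have "measure R (P E \<inter> P F) = 0" by linarith
    then show ?thesis using P EF by (auto simp: null_sets_def R.emeasure_eq_measure)
  qed
  define HL where "HL i r = Q \<inter> {y. y$i \<le> r}" for i :: 'd and r :: real
  define HR where "HR i s = Q \<inter> {y. s \<le> y$i}" for i :: 'd and s :: real
  have comp: "compact (HL i r)" "compact (HR i r)" for i r
    unfolding HL_def HR_def
    by (auto intro!: compact_Int_closed Q closed_Collect_le continuous_intros)
  define I :: "('d \<times> real \<times> real) set" where "I = {(i, r, s). r \<in> \<rat> \<and> s \<in> \<rat> \<and> r < s}"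
  have "countable I"
    by (rule countable_subset[of _ "UNIV \<times> \<rat> \<times> \<rat>"])
      (auto simp: I_def intro!: countable_SIGMA countable_rat)
  define Z where "Z = (\<Union>(i, r, s)\<in>I. P (HL i r) \<inter> P (HR i s))"
  have Z: "Z \<in> null_sets R"
    unfolding Z_def
    by (rule null_sets_UN'[OF \<open>countable I\<close>])
      (auto intro!: null[OF comp] simp: I_def, auto simp: HL_def HR_def)
  define G where "G = P Q - Z"
  have G: "G \<in> sets R" using Z P[OF Q] by (auto simp: G_def)
  have PQ: "AE x in R. x \<in> P Q"
    using \<mu>K[OF Q] \<mu>p(3) P[OF Q] by (intro R.AE_prob_1) (simp add: measure_def)
  have AEG: "AE x in R. x \<in> G"
    using PQ AE_not_in[OF Z] by eventually_elim (auto simp: G_def)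
  have unique: "y = z" if x: "x \<in> G" and yz: "y \<in> Q" "z \<in> Q" "y \<in> subgradients u x" "z \<in> subgradients u x"
    for x y z
  proof (rule ccontr)
    assume "y \<noteq> z"
    obtain i r s where irs: "r \<in> \<rat>" "s \<in> \<rat>" "r < s"
      and d: "y$i \<le> r \<and> s \<le> z$i \<or> z$i \<le> r \<and> s \<le> y$i"
      using separating_halfspaces[OF \<open>y \<noteq> z\<close>] by (elim exE bexE conjE) (rule that; assumption)
    have "x \<in> P (HL i r) \<inter> P (HR i s)"
      using d yz by (auto simp: P_def HL_def HR_def)
    then have "x \<in> Z" using irs unfolding Z_def I_def by fast
    then show False using x by (simp add: G_def)
  qed
  obtain q0 where q0: "q0 \<in> Q" using \<mu>p(3) by (cases "Q = {}") auto
  define T where "T x = (if x \<in> G then SOME y. y \<in> Q \<and> y \<in> subgradients u x else q0)" for x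
  have TG: "T x \<in> Q \<and> T x \<in> subgradients u x" if "x \<in> G" for x
  proof -
    have "\<exists>y. y \<in> Q \<and> y \<in> subgradients u x" using that by (auto simp: G_def P_def)
    from someI_ex[OF this] show ?thesis using that by (simp add: T_def)
  qed
  have TQ: "T x \<in> Q" for x using TG q0 by (cases "x \<in> G") (auto simp: T_def)
  \<comment> \<open>On \<open>G\<close> the value of \<open>T\<close> is the only subgradient in \<open>Q\<close>, so it lies in \<open>C\<close> as soon as
    some subgradient lies in \<open>Q \<inter> C\<close>.\<close>
  have pre: "T -` C \<inter> G = P (Q \<inter> C) \<inter> G" for C
  proof (intro equalityI subsetI)
    fix x assume "x \<in> T -` C \<inter> G"
    then show "x \<in> P (Q \<inter> C) \<inter> G" using TG[of x] by (auto simp: P_def)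
  next
    fix x assume "x \<in> P (Q \<inter> C) \<inter> G"
    then obtain y where y: "x \<in> G" "y \<in> Q" "y \<in> C" "y \<in> subgradients u x"
      by (auto simp: P_def)
    then have "T x = y" using unique[of x] TG[of x] by blast
    then show "x \<in> T -` C \<inter> G" using y by simp
  qed
  have preC: "T -` C = (P (Q \<inter> C) \<inter> G) \<union> (if q0 \<in> C then - G else {})" for C
  proof -
    have "T x = q0" if "x \<notin> G" for x using that by (simp add: T_def)
    then have "T -` C - G = (if q0 \<in> C then - G else {})" by auto
    then show ?thesis unfolding pre[symmetric] by blast
  qed
  have T: "T \<in> borel_measurable borel"
  proof (rule borel_measurableI)
    fix S :: "(real^'d) set" assume "open S"
    then have c: "compact (Q \<inter> (- S))" using Q by (intro compact_Int_closed) auto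
    have "T -` (- S) \<in> sets borel"
      unfolding preC using P[OF c] G R(2) by auto
    then have "- (T -` (- S)) \<in> sets borel" by (rule borel_comp)
    then show "T -` S \<inter> space borel \<in> sets borel" by (simp add: vimage_Compl)
  qed
  have TR: "T \<in> measurable R borel" using T R(2) by (simp cong: measurable_cong_sets)
  have "\<mu> = distr R borel T"
  proof (rule borel_measure_eqI_closed)
    fix C :: "(real^'d) set" assume C: "closed C"
    have cQ: "compact (Q \<inter> C)" using Q C by (rule compact_Int_closed)
    have AEQ: "AE y in \<mu>. y \<in> Q"
      using \<mu>p by (intro \<mu>.AE_prob_1) (simp add: measure_def)
    have "emeasure \<mu> C = emeasure \<mu> (Q \<inter> C)"
      using AEQ C \<mu>p(1) by (intro emeasure_eq_AE) (auto simp: borel_closed)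
    also have "\<dots> = emeasure R (P (Q \<inter> C))" by (rule \<mu>K[OF cQ])
    also have "\<dots> = emeasure R (T -` C \<inter> space R)"
    proof (rule emeasure_eq_AE)
      show "AE x in R. x \<in> P (Q \<inter> C) \<longleftrightarrow> x \<in> T -` C \<inter> space R"
        using AEG by eventually_elim (use pre[of C] in \<open>auto simp: spR\<close>)
      show "T -` C \<inter> space R \<in> sets R" using TR C by (auto simp: borel_closed intro: measurable_sets)
    qed (rule P[OF cQ])
    also have "\<dots> = emeasure (distr R borel T) C"
      using TR C by (simp add: emeasure_distr borel_closed)
    finally show "emeasure \<mu> C = emeasure (distr R borel T) C" .
  qed (use \<mu>p in \<open>auto intro: \<mu>.finite_measure_axioms\<close>)
  moreover have "AE x in R. T x \<in> subgradients u x"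
    using AEG by eventually_elim (use TG in auto)
  ultimately show ?thesis using that[OF T] TQ by blast
qed

section \<open>From lines to several dimensions\<close>

text \<open>Averaging over translates in a fixed direction replaces a decomposition of space into parallel
lines: every estimate on unit segments integrates to one on the whole space.\<close>
lemma nn_integral_segment_average:
  fixes H :: "'a::euclidean_space \<Rightarrow> ennreal"
  assumes [measurable]: "H \<in> borel_measurable borel"
  shows "(\<integral>\<^sup>+x. (\<integral>\<^sup>+t. indicator {0..1::real} t * H (x + t *\<^sub>R e) \<partial>lborel) \<partial>lborel) = (\<integral>\<^sup>+x. H x \<partial>lborel)"
proof -
  have [measurable]: "(\<lambda>(x::'a, t::real). indicator {0..1} t * H (x + t *\<^sub>R e))
      \<in> borel_measurable (lborel \<Otimes>\<^sub>M lborel)"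
    by measurable
  have "(\<integral>\<^sup>+x. (\<integral>\<^sup>+t. indicator {0..1} t * H (x + t *\<^sub>R e) \<partial>lborel) \<partial>lborel)
      = (\<integral>\<^sup>+t. (\<integral>\<^sup>+x. indicator {0..1} t * H (x + t *\<^sub>R e) \<partial>lborel) \<partial>lborel)"
    by (rule lborel_pair.Fubini'[symmetric]) measurable
  also have "\<dots> = (\<integral>\<^sup>+t. indicator {0..1::real} t * (\<integral>\<^sup>+x. H x \<partial>lborel) \<partial>lborel)"
  proof (rule nn_integral_cong)
    fix t :: real
    have "(\<integral>\<^sup>+x. H x \<partial>lborel) = (\<integral>\<^sup>+x. H x \<partial>distr lborel borel ((+) (t *\<^sub>R e)))"
      by (simp add: lborel_distr_plus)
    also have "\<dots> = (\<integral>\<^sup>+x. H (x + t *\<^sub>R e) \<partial>lborel)"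
      by (subst nn_integral_distr) (auto simp: add.commute)
    finally show "(\<integral>\<^sup>+x. indicator {0..1} t * H (x + t *\<^sub>R e) \<partial>lborel)
        = indicator {0..1} t * (\<integral>\<^sup>+x. H x \<partial>lborel)"
      by (simp add: nn_integral_cmult)
  qed
  also have "\<dots> = (\<integral>\<^sup>+x. H x \<partial>lborel)"
    by (simp add: nn_integral_multc)
  finally show ?thesis .
qed

lemma AE_segment:
  fixes e :: "'a::euclidean_space"
  assumes "AE x in lborel. P x"
  shows "AE x in lborel. AE t in lborel. t \<in> {0..1::real} \<longrightarrow> P (x + t *\<^sub>R e)"
proof -
  obtain N where N: "\<And>x. x \<in> space lborel - N \<Longrightarrow> P x" "N \<in> null_sets lborel"
    using AE_E3[OF assms] by blast
  have [measurable]: "N \<in> sets borel" using N by auto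
  have "(\<integral>\<^sup>+x. (\<integral>\<^sup>+t. indicator {0..1::real} t * indicator N (x + t *\<^sub>R e) \<partial>lborel) \<partial>lborel) = 0"
    using N nn_integral_segment_average[of "indicator N" e] by auto
  then have "AE x in lborel. (\<integral>\<^sup>+t. indicator {0..1::real} t * indicator N (x + t *\<^sub>R e) \<partial>lborel) = 0"
    by (subst (asm) nn_integral_0_iff_AE) measurable
  then show ?thesis
  proof eventually_elim
    case (elim x)
    then have "AE t in lborel. indicator {0..1::real} t * indicator N (x + t *\<^sub>R e) = (0::ennreal)"
      by (subst (asm) nn_integral_0_iff_AE) measurable
    then show ?case
      by eventually_elim (use N in \<open>auto simp: indicator_def split: if_splits\<close>)
  qed
qed

lemma subgradient_restrict_line:
  assumes "y \<in> subgradients u (x + t *\<^sub>R e)"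
  shows "u (x + t *\<^sub>R e) + (y \<bullet> e) * (s - t) \<le> u (x + s *\<^sub>R e)"
proof -
  have "(x + s *\<^sub>R e) - (x + t *\<^sub>R e) = (s - t) *\<^sub>R e" by (simp add: algebra_simps)
  moreover have "u (x + t *\<^sub>R e) + y \<bullet> ((x + s *\<^sub>R e) - (x + t *\<^sub>R e)) \<le> u (x + s *\<^sub>R e)"
    using assms unfolding subgradients_def mem_Collect_eq by (rule spec)
  ultimately show ?thesis by (simp add: mult.commute)
qed

text \<open>The part of the segment lying in \<open>X\<close> is again a segment, by convexity, and the one-dimensional
inequality applies to it. The set \<open>B\<close> records which segments meet \<open>X\<close> at all; without it, the
additive term \<open>\<delta>\<close> would have an infinite integral over the base points \<open>x\<close>.\<close>
lemma nn_integral_line_gradient_difference_le: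
  fixes u v :: "'a::euclidean_space \<Rightarrow> real" and T S :: "'a \<Rightarrow> 'a"
  assumes X: "compact X" "convex X" and L: "0 < L" and lam: "0 < \<delta>"
    and u: "convex_on UNIV u" and v: "convex_on UNIV v"
    and su: "\<And>x. x \<in> X \<Longrightarrow> \<exists>y\<in>subgradients u x. \<bar>y \<bullet> e\<bar> \<le> L"
    and sv: "\<And>x. x \<in> X \<Longrightarrow> \<exists>y\<in>subgradients v x. \<bar>y \<bullet> e\<bar> \<le> L"
    and [measurable]: "T \<in> borel_measurable borel" "S \<in> borel_measurable borel"
    and T: "AE t in lborel. t \<in> {0..1} \<longrightarrow> x + t *\<^sub>R e \<in> X \<longrightarrow> T (x + t *\<^sub>R e) \<in> subgradients u (x + t *\<^sub>R e)"
    and S: "AE t in lborel. t \<in> {0..1} \<longrightarrow> x + t *\<^sub>R e \<in> X \<longrightarrow> S (x + t *\<^sub>R e) \<in> subgradients v (x + t *\<^sub>R e)"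
    and B: "\<And>t. t \<in> {0..1} \<Longrightarrow> x + t *\<^sub>R e \<in> X \<Longrightarrow> x \<in> B"
  shows "(\<integral>\<^sup>+t. indicator {0..1} t * (indicator X (x + t *\<^sub>R e) *
        ennreal (((T (x + t *\<^sub>R e) - S (x + t *\<^sub>R e)) \<bullet> e)\<^sup>2)) \<partial>lborel)
    \<le> ennreal (128 * L\<^sup>2 + 8 * L) * ((\<integral>\<^sup>+t. indicator {0..1} t * (indicator X (x + t *\<^sub>R e) *
        ennreal ((u (x + t *\<^sub>R e) - v (x + t *\<^sub>R e))\<^sup>2)) \<partial>lborel) * ennreal (1 / \<delta>\<^sup>2)
      + ennreal \<delta> * indicator B x)"
proof -
  define J where "J = {t \<in> {0..1}. x + t *\<^sub>R e \<in> X}"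
  have J_eq: "J = {0..1} \<inter> (\<lambda>t. x + t *\<^sub>R e) -` X" by (auto simp: J_def)
  have "closed ((\<lambda>t. x + t *\<^sub>R e) -` X)"
    using X by (intro closed_vimage compact_imp_closed) (auto intro!: continuous_intros)
  then have "compact J" unfolding J_eq by (intro compact_Int_closed) auto
  moreover have "convex J"
  proof -
    have "convex ((\<lambda>t. x + t *\<^sub>R e) -` X)"
    proof (rule convexI)
      fix s t \<alpha> \<beta> :: real
      assume *: "s \<in> (\<lambda>t. x + t *\<^sub>R e) -` X" "t \<in> (\<lambda>t. x + t *\<^sub>R e) -` X"
        "0 \<le> \<alpha>" "0 \<le> \<beta>" "\<alpha> + \<beta> = 1"
      have "x + (\<alpha> *\<^sub>R s + \<beta> *\<^sub>R t) *\<^sub>R e = (\<alpha> + \<beta>) *\<^sub>R x + (\<alpha> *\<^sub>R s + \<beta> *\<^sub>R t) *\<^sub>R e"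
        using * by simp
      also have "\<dots> = \<alpha> *\<^sub>R (x + s *\<^sub>R e) + \<beta> *\<^sub>R (x + t *\<^sub>R e)"
        by (simp add: algebra_simps)
      also have "\<dots> \<in> X" using * X(2) by (intro convexD) auto
      finally show "\<alpha> *\<^sub>R s + \<beta> *\<^sub>R t \<in> (\<lambda>t. x + t *\<^sub>R e) -` X" by simp
    qed
    then show ?thesis unfolding J_eq by (intro convex_Int) auto
  qed
  ultimately obtain a b where J: "J = {a..b}"
    using connected_compact_interval_1[of J] convex_connected by auto
  have memJ: "t \<in> {a..b} \<longleftrightarrow> t \<in> {0..1} \<and> x + t *\<^sub>R e \<in> X" for t
    unfolding J[symmetric] J_def by (rule mem_Collect_eq)
  have indJ: "(\<lambda>t. indicator {0..1} t * (indicator X (x + t *\<^sub>R e) * ennreal (w t)))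
      = (\<lambda>t. ennreal (if t \<in> {a..b} then w t else 0))" for w :: "real \<Rightarrow> real"
  proof
    fix t
    show "indicator {0..1} t * (indicator X (x + t *\<^sub>R e) * ennreal (w t))
        = ennreal (if t \<in> {a..b} then w t else 0)"
      using memJ[of t]
      by (cases "t \<in> {0..1}"; cases "x + t *\<^sub>R e \<in> X") (simp_all del: atLeastAtMost_iff)
  qed
  show ?thesis
  proof (cases "a \<le> b")
    case False
    then show ?thesis unfolding indJ by simp
  next
    case ab: True
    then have "a \<in> {a..b}" by simp
    then have "x \<in> B" using B[of a] memJ[of a] by blast
    have inX: "x + t *\<^sub>R e \<in> X" "t \<in> {0..1}" if "t \<in> {a..b}" for t
      using that memJ by blast+
    obtain \<tau>' where \<tau>': "\<And>x. x \<in> X \<Longrightarrow> \<tau>' x \<in> subgradients u x \<and> \<bar>\<tau>' x \<bullet> e\<bar> \<le> L"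
      using su by metis
    obtain \<sigma>' where \<sigma>': "\<And>x. x \<in> X \<Longrightarrow> \<sigma>' x \<in> subgradients v x \<and> \<bar>\<sigma>' x \<bullet> e\<bar> \<le> L"
      using sv by metis
    define \<tau> where "\<tau> t = \<tau>' (x + t *\<^sub>R e) \<bullet> e" for t
    define \<sigma> where "\<sigma> t = \<sigma>' (x + t *\<^sub>R e) \<bullet> e" for t
    define g where "g t = u (x + t *\<^sub>R e)" for t
    define k where "k t = v (x + t *\<^sub>R e)" for t
    have g: "g t + \<tau> t * (s - t) \<le> g s" if "s \<in> {a..b}" "t \<in> {a..b}" for s t
      unfolding g_def \<tau>_def using \<tau>' inX(1)[OF that(2)] by (intro subgradient_restrict_line) auto
    have k: "k t + \<sigma> t * (s - t) \<le> k s" if "s \<in> {a..b}" "t \<in> {a..b}" for s t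
      unfolding k_def \<sigma>_def using \<sigma>' inX(1)[OF that(2)] by (intro subgradient_restrict_line) auto
    obtain I A where I: "((\<lambda>t. (\<tau> t - \<sigma> t)\<^sup>2) has_integral I) {a..b}"
      and A: "((\<lambda>t. (g t - k t)\<^sup>2) has_integral A) {a..b}"
      and IA: "I \<le> (128 * L\<^sup>2 + 8 * L) * (A / \<delta>\<^sup>2 + \<delta>)"
      using integral_square_subgradient_difference_le[OF ab L lam g k] \<tau>' \<sigma>' inX
      unfolding \<tau>_def \<sigma>_def by blast
    have A0: "0 \<le> A" using has_integral_nonneg[OF A] by simp
    have [measurable]: "u \<in> borel_measurable borel" "v \<in> borel_measurable borel"
      using u v by (auto intro!: borel_measurable_continuous_onI continuous_on_convex_UNIV)
    have "AE t in lborel. t \<in> {a..b} \<longrightarrow> T (x + t *\<^sub>R e) \<bullet> e = \<tau> t"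
    proof (rule subgradient_selection_ae_unique[OF g])
      show "AE t in lborel. t \<in> {a..b} \<longrightarrow> (\<forall>s\<in>{a..b}. g t + (T (x + t *\<^sub>R e) \<bullet> e) * (s - t) \<le> g s)"
        using T by eventually_elim (use inX in \<open>auto simp: g_def intro!: subgradient_restrict_line\<close>)
    qed
    moreover have "AE t in lborel. t \<in> {a..b} \<longrightarrow> S (x + t *\<^sub>R e) \<bullet> e = \<sigma> t"
    proof (rule subgradient_selection_ae_unique[OF k])
      show "AE t in lborel. t \<in> {a..b} \<longrightarrow> (\<forall>s\<in>{a..b}. k t + (S (x + t *\<^sub>R e) \<bullet> e) * (s - t) \<le> k s)"
        using S by eventually_elim (use inX in \<open>auto simp: k_def intro!: subgradient_restrict_line\<close>)
    qed
    ultimately have "AE t in lborel. t \<in> {a..b} \<longrightarrow>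
        ((T (x + t *\<^sub>R e) - S (x + t *\<^sub>R e)) \<bullet> e)\<^sup>2 = (\<tau> t - \<sigma> t)\<^sup>2"
      by eventually_elim (simp add: inner_diff_left)
    from has_integral_AE[OF this] I
    have I': "((\<lambda>t. ((T (x + t *\<^sub>R e) - S (x + t *\<^sub>R e)) \<bullet> e)\<^sup>2) has_integral I) {a..b}" by simp
    have nnI: "(\<integral>\<^sup>+t. ennreal (if t \<in> {a..b} then ((T (x + t *\<^sub>R e) - S (x + t *\<^sub>R e)) \<bullet> e)\<^sup>2 else 0) \<partial>lborel) = ennreal I"
      by (rule nn_integral_has_integral_lborel[OF _ _ has_integral_restrict_UNIV[THEN iffD2, OF I']]) auto
    have nnA: "(\<integral>\<^sup>+t. ennreal (if t \<in> {a..b} then (u (x + t *\<^sub>R e) - v (x + t *\<^sub>R e))\<^sup>2 else 0) \<partial>lborel) = ennreal A"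
      by (rule nn_integral_has_integral_lborel[OF _ _ has_integral_restrict_UNIV[THEN iffD2, OF A[unfolded g_def k_def]]]) auto
    have "ennreal I \<le> ennreal ((128 * L\<^sup>2 + 8 * L) * (A * (1 / \<delta>\<^sup>2) + \<delta>))"
      using IA by (intro ennreal_leI) simp
    also have "\<dots> = ennreal (128 * L\<^sup>2 + 8 * L) * (ennreal A * ennreal (1 / \<delta>\<^sup>2) + ennreal \<delta>)"
      using A0 L lam by (simp add: ennreal_mult[symmetric] ennreal_plus[symmetric] del: ennreal_plus)
    finally show ?thesis
      unfolding indJ nnI nnA using \<open>x \<in> B\<close> by simp
  qed
qed

lemma nn_integral_gradient_difference_le:
  fixes u v :: "'a::euclidean_space \<Rightarrow> real" and T S :: "'a \<Rightarrow> 'a"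
  assumes X: "compact X" "convex X" and L: "0 < L" and lam: "0 < \<delta>"
    and u: "convex_on UNIV u" and v: "convex_on UNIV v"
    and su: "\<And>x. x \<in> X \<Longrightarrow> \<exists>y\<in>subgradients u x. \<bar>y \<bullet> e\<bar> \<le> L"
    and sv: "\<And>x. x \<in> X \<Longrightarrow> \<exists>y\<in>subgradients v x. \<bar>y \<bullet> e\<bar> \<le> L"
    and [measurable]: "T \<in> borel_measurable borel" "S \<in> borel_measurable borel"
    and T: "AE x in lborel. x \<in> X \<longrightarrow> T x \<in> subgradients u x"
    and S: "AE x in lborel. x \<in> X \<longrightarrow> S x \<in> subgradients v x"
    and B: "\<And>x t. t \<in> {0..1} \<Longrightarrow> x + t *\<^sub>R e \<in> X \<Longrightarrow> x \<in> B" and [measurable]: "B \<in> sets borel"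
  shows "(\<integral>\<^sup>+x. indicator X x * ennreal (((T x - S x) \<bullet> e)\<^sup>2) \<partial>lborel)
    \<le> ennreal (128 * L\<^sup>2 + 8 * L) * ((\<integral>\<^sup>+x. indicator X x * ennreal ((u x - v x)\<^sup>2) \<partial>lborel) * ennreal (1 / \<delta>\<^sup>2)
      + ennreal \<delta> * emeasure lborel B)"
proof -
  have [measurable]: "X \<in> sets borel" using X by (simp add: borel_closed compact_imp_closed)
  have [measurable]: "u \<in> borel_measurable borel" "v \<in> borel_measurable borel"
    using u v by (auto intro!: borel_measurable_continuous_onI continuous_on_convex_UNIV)
  define H where "H x = indicator X x * ennreal (((T x - S x) \<bullet> e)\<^sup>2)" for x
  define K where "K x = indicator X x * ennreal ((u x - v x)\<^sup>2)" for x
  have [measurable]: "H \<in> borel_measurable borel" "K \<in> borel_measurable borel"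
    unfolding H_def K_def by measurable
  have "(\<integral>\<^sup>+x. H x \<partial>lborel) = (\<integral>\<^sup>+x. (\<integral>\<^sup>+t. indicator {0..1} t * H (x + t *\<^sub>R e) \<partial>lborel) \<partial>lborel)"
    by (simp add: nn_integral_segment_average)
  also have "\<dots> \<le> (\<integral>\<^sup>+x. ennreal (128 * L\<^sup>2 + 8 * L) *
      ((\<integral>\<^sup>+t. indicator {0..1} t * K (x + t *\<^sub>R e) \<partial>lborel) * ennreal (1 / \<delta>\<^sup>2) + ennreal \<delta> * indicator B x) \<partial>lborel)"
  proof (rule nn_integral_mono_AE)
    show "AE x in lborel. (\<integral>\<^sup>+t. indicator {0..1} t * H (x + t *\<^sub>R e) \<partial>lborel) \<le> ennreal (128 * L\<^sup>2 + 8 * L) *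
      ((\<integral>\<^sup>+t. indicator {0..1} t * K (x + t *\<^sub>R e) \<partial>lborel) * ennreal (1 / \<delta>\<^sup>2) + ennreal \<delta> * indicator B x)"
      using AE_segment[OF T, of e] AE_segment[OF S, of e]
    proof eventually_elim
      case (elim x)
      show ?case unfolding H_def K_def
        by (rule nn_integral_line_gradient_difference_le[OF X L lam u v su sv _ _ elim B]) simp_all
    qed
  qed
  also have "\<dots> = ennreal (128 * L\<^sup>2 + 8 * L) *
      ((\<integral>\<^sup>+x. (\<integral>\<^sup>+t. indicator {0..1} t * K (x + t *\<^sub>R e) \<partial>lborel) \<partial>lborel) * ennreal (1 / \<delta>\<^sup>2)
        + ennreal \<delta> * emeasure lborel B)"
    by (simp add: nn_integral_cmult nn_integral_add nn_integral_multc)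
  also have "(\<integral>\<^sup>+x. (\<integral>\<^sup>+t. indicator {0..1} t * K (x + t *\<^sub>R e) \<partial>lborel) \<partial>lborel) = (\<integral>\<^sup>+x. K x \<partial>lborel)"
    by (rule nn_integral_segment_average) measurable
  finally show ?thesis unfolding H_def K_def .
qed

section \<open>Supports, couplings and Wasserstein distances\<close>

text \<open>The complement of the support is covered by open null sets, of which countably many suffice.\<close>
lemma AE_measure_support:
  fixes M :: "'a::second_countable_topology measure"
  assumes "sets M = sets borel"
  shows "AE x in M. x \<in> measure_support M"
proof -
  define \<U> where "\<U> = {U :: 'a set. open U \<and> emeasure M U = 0}"
  obtain \<V> where \<V>: "\<V> \<subseteq> \<U>" "countable \<V>" "\<Union>\<V> = \<Union>\<U>"
    using Lindelof[of \<U>] by (auto simp: \<U>_def)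
  have "\<V> \<subseteq> null_sets M"
    using \<V>(1) assms by (auto simp: \<U>_def null_sets_def)
  then have "(\<Union>U\<in>\<V>. U) \<in> null_sets M"
    using \<V>(2) by (intro null_sets_UN') auto
  then have "AE x in M. x \<notin> (\<Union>U\<in>\<V>. U)" by (rule AE_not_in)
  moreover have "x \<in> measure_support M" if "x \<notin> (\<Union>U\<in>\<V>. U)" for x
    using that \<V>(3) by (auto simp: measure_support_def \<U>_def zero_less_iff_neq_zero)
  ultimately show ?thesis by auto
qed

lemma measure_support_subset:
  assumes "N \<in> prob_measures_on Q" "closed Q"
  shows "measure_support N \<subseteq> Q"
proof
  interpret prob_space N using assms by (simp add: prob_measures_on_def)
  fix x assume "x \<in> measure_support N"
  moreover have "emeasure N (- Q) = 0"
  proof -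
    have Q: "Q \<in> sets N" "space N = UNIV"
      using assms sets_eq_imp_space_eq[of N borel] by (auto simp: prob_measures_on_def borel_closed)
    then have "prob (UNIV - Q) = 1 - prob Q" using prob_compl[of Q] by simp
    then show ?thesis
      using assms by (simp add: prob_measures_on_def emeasure_eq_measure Compl_eq_Diff_UNIV)
  qed
  ultimately show "x \<in> Q" using assms by (force simp: measure_support_def)
qed

lemma AE_prob_measures_on:
  assumes "N \<in> prob_measures_on Q"
  shows "AE x in N. x \<in> Q"
proof -
  interpret prob_space N using assms by (simp add: prob_measures_on_def)
  show ?thesis using assms by (intro AE_prob_1) (simp add: prob_measures_on_def measure_def)
qed

lemma prob_measures_on_distr:
  assumes "prob_space R" "T \<in> measurable R borel" "range T \<subseteq> Q" "Q \<in> sets borel"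
  shows "distr R borel T \<in> prob_measures_on Q"
proof -
  interpret prob_space R by fact
  have "T -` Q \<inter> space R = space R" using assms by auto
  then show ?thesis
    using assms prob_space_distr[of T borel]
    by (auto simp: prob_measures_on_def emeasure_distr emeasure_space_1)
qed

text \<open>Without a coupling, the infimum defining the Wasserstein distance would be \<open>\<infinity>\<close> and be converted
to the real number \<open>0\<close>.\<close>
lemma couplings_nonempty:
  fixes M N :: "(real^'d) measure"
  assumes "prob_space M" "sets M = sets borel" "prob_space N" "sets N = sets borel"
  shows "M \<Otimes>\<^sub>M N \<in> couplings M N"
proof -
  interpret M: prob_space M by fact
  interpret N: prob_space N by fact
  interpret P: pair_prob_space M N ..
  have "sets (M \<Otimes>\<^sub>M N) = sets borel"
    using sets_pair_measure_cong[OF assms(2,4)] by (simp only: borel_prod)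
  moreover have "distr (M \<Otimes>\<^sub>M N) borel fst = M"
    using N.distr_pair_fst[of M] assms distr_cong[of "M \<Otimes>\<^sub>M N" "M \<Otimes>\<^sub>M N" borel M fst fst] by simp
  moreover have "distr (M \<Otimes>\<^sub>M N) borel snd = N"
  proof (rule measure_eqI)
    fix A assume "A \<in> sets (distr (M \<Otimes>\<^sub>M N) borel snd)"
    then have A: "A \<in> sets N" using assms by simp
    then have "snd -` A \<inter> space (M \<Otimes>\<^sub>M N) = space M \<times> A"
      using sets.sets_into_space by (auto simp: space_pair_measure)
    then show "emeasure (distr (M \<Otimes>\<^sub>M N) borel snd) A = emeasure N A"
      using A assms N.emeasure_pair_measure_Times[of "space M" M A]
      by (subst emeasure_distr) (auto simp: M.emeasure_space_1 cong: measurable_cong_sets)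
  qed (use assms in simp)
  ultimately show ?thesis using P.prob_space_axioms by (simp add: couplings_def)
qed

lemma AE_couplings:
  assumes G: "G \<in> couplings M N"
  shows "AE x in M. P x \<Longrightarrow> AE z in G. P (fst z)" "AE y in N. P' y \<Longrightarrow> AE z in G. P' (snd z)"
proof -
  have fs: "fst \<in> measurable G borel" "snd \<in> measurable G borel"
    using G by (auto simp: couplings_def cong: measurable_cong_sets intro!: borel_measurable_continuous_onI continuous_intros)
  have MN: "M = distr G borel fst" "N = distr G borel snd" using G by (auto simp: couplings_def)
  show "AE x in M. P x \<Longrightarrow> AE z in G. P (fst z)"
    unfolding MN(1) by (rule AE_distrD[OF fs(1)])
  show "AE y in N. P' y \<Longrightarrow> AE z in G. P' (snd z)"
    unfolding MN(2) by (rule AE_distrD[OF fs(2)])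
qed

lemma couplings_distr:
  fixes S T :: "real^'d \<Rightarrow> real^'d"
  assumes "prob_space R" and [measurable]: "S \<in> measurable R borel" "T \<in> measurable R borel"
  shows "distr R borel (\<lambda>x. (S x, T x)) \<in> couplings (distr R borel S) (distr R borel T)"
proof -
  interpret prob_space R by fact
  have [measurable]: "(\<lambda>x. (S x, T x)) \<in> measurable R borel"
    by (simp add: borel_prod[symmetric])
  have [measurable]: "fst \<in> measurable borel (borel :: (real^'d) measure)"
    "snd \<in> measurable borel (borel :: (real^'d) measure)"
    by (auto intro!: borel_measurable_continuous_onI continuous_intros)
  show ?thesis
    by (auto simp: couplings_def distr_distr comp_def intro!: prob_space_distr)
qed

lemma wasserstein_nonneg: "0 \<le> wasserstein p M N"
  by (simp add: wasserstein_def)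

lemma quantization_bdd_below:
  "bdd_below {wasserstein p M N | N.
    N \<in> prob_measures_on Q \<and> finite (measure_support N) \<and> card (measure_support N) \<le> n}"
  by (rule bdd_belowI[of _ 0]) (auto simp: wasserstein_nonneg)

text \<open>Here \<open>m\<close> is meant to be the distance to the support of \<open>N\<close>: no transport plan can move a
point by less. Boundedness of \<open>Q\<close> makes the infimum finite, so that its conversion to a real number
loses nothing.\<close>
lemma wasserstein_one_ge:
  fixes M N :: "(real^'d) measure"
  assumes M: "M \<in> prob_measures_on Q" and N: "N \<in> prob_measures_on Q"
    and L: "\<And>y. y \<in> Q \<Longrightarrow> norm y \<le> L"
    and m: "m \<in> borel_measurable borel"
    and le: "\<And>y s. s \<in> measure_support N \<Longrightarrow> m y \<le> (\<Sum>i\<in>UNIV. \<bar>y $ i - s $ i\<bar>)"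
  shows "(\<integral>\<^sup>+y. ennreal (m y) \<partial>M) \<le> ennreal (wasserstein 1 M N)"
proof -
  let ?c = "\<lambda>z::(real^'d) \<times> (real^'d). ennreal (\<Sum>i\<in>UNIV. \<bar>fst z $ i - snd z $ i\<bar> powr 1)"
  let ?W = "INF G\<in>couplings M N. \<integral>\<^sup>+z. ?c z \<partial>G"
  have p: "prob_space M" "sets M = sets borel" "prob_space N" "sets N = sets borel"
    using M N by (auto simp: prob_measures_on_def)
  have "(\<integral>\<^sup>+y. ennreal (m y) \<partial>M) \<le> ?W"
  proof (rule INF_greatest)
    fix G assume G: "G \<in> couplings M N"
    have fs: "fst \<in> measurable G borel"
      using G by (auto simp: couplings_def cong: measurable_cong_sets intro!: borel_measurable_continuous_onI continuous_intros)
    have "(\<integral>\<^sup>+y. ennreal (m y) \<partial>M) = (\<integral>\<^sup>+y. ennreal (m y) \<partial>distr G borel fst)"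
      using G by (simp add: couplings_def)
    also have "\<dots> = (\<integral>\<^sup>+z. ennreal (m (fst z)) \<partial>G)"
      using m by (intro nn_integral_distr fs) auto
    also have "\<dots> \<le> (\<integral>\<^sup>+z. ?c z \<partial>G)"
    proof (rule nn_integral_mono_AE)
      show "AE z in G. ennreal (m (fst z)) \<le> ?c z"
        using AE_couplings(2)[OF G AE_measure_support[OF p(4)]]
        by eventually_elim (use le in \<open>auto intro!: ennreal_leI\<close>)
    qed
    finally show "(\<integral>\<^sup>+y. ennreal (m y) \<partial>M) \<le> (\<integral>\<^sup>+z. ?c z \<partial>G)" .
  qed
  moreover have "?W < \<top>"
  proof -
    let ?G = "M \<Otimes>\<^sub>M N"
    have G: "?G \<in> couplings M N" by (rule couplings_nonempty[OF p])
    then interpret G: prob_space ?G by (simp add: couplings_def)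
    have "?W \<le> (\<integral>\<^sup>+z. ?c z \<partial>?G)" using G by (rule INF_lower)
    also have "\<dots> \<le> (\<integral>\<^sup>+z. ennreal (real CARD('d) * (2 * L)) \<partial>?G)"
    proof (rule nn_integral_mono_AE)
      show "AE z in ?G. ?c z \<le> ennreal (real CARD('d) * (2 * L))"
        using AE_couplings(1)[OF G AE_prob_measures_on[OF M]] AE_couplings(2)[OF G AE_prob_measures_on[OF N]]
      proof eventually_elim
        case (elim z)
        have "\<bar>fst z $ i - snd z $ i\<bar> \<le> 2 * L" for i
          using component_le_norm_cart[of "fst z" i] component_le_norm_cart[of "snd z" i]
            L[OF elim(1)] L[OF elim(2)] by linarith
        then have "(\<Sum>i\<in>UNIV. \<bar>fst z $ i - snd z $ i\<bar>) \<le> real CARD('d) * (2 * L)"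
          by (intro sum_bounded_above) auto
        then show ?case by (auto intro!: ennreal_leI)
      qed
    qed
    also have "\<dots> < \<top>" by (simp add: G.emeasure_space_1)
    finally show ?thesis .
  qed
  ultimately show ?thesis by (simp add: wasserstein_def)
qed

lemma wasserstein_two_square_le:
  fixes S T :: "real^'d \<Rightarrow> real^'d"
  assumes R: "prob_space R" and [measurable]: "T \<in> measurable R borel" "S \<in> measurable R borel"
    and le: "(\<integral>\<^sup>+x. ennreal (\<Sum>i\<in>UNIV. (T x $ i - S x $ i)\<^sup>2) \<partial>R) \<le> ennreal B" and "0 \<le> B"
  shows "(wasserstein 2 (distr R borel T) (distr R borel S))\<^sup>2 \<le> B"
proof -
  let ?c = "\<lambda>z::(real^'d) \<times> (real^'d). ennreal (\<Sum>i\<in>UNIV. \<bar>fst z $ i - snd z $ i\<bar> powr 2)"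
  let ?G = "distr R borel (\<lambda>x. (T x, S x))"
  let ?W = "INF G\<in>couplings (distr R borel T) (distr R borel S). \<integral>\<^sup>+z. ?c z \<partial>G"
  have sq: "\<bar>a\<bar> powr 2 = a\<^sup>2" for a :: real
    by (cases "a = 0") (simp_all add: powr_numeral)
  have [measurable]: "(\<lambda>x. (T x, S x)) \<in> measurable R borel"
    by (simp add: borel_prod[symmetric])
  have c: "?c \<in> borel_measurable borel"
    unfolding sq by (intro measurable_compose[OF _ measurable_ennreal] borel_measurable_continuous_onI continuous_intros)
  have "?W \<le> (\<integral>\<^sup>+z. ?c z \<partial>?G)"
    using couplings_distr[OF R] by (intro INF_lower) simp
  also have "\<dots> = (\<integral>\<^sup>+x. ennreal (\<Sum>i\<in>UNIV. (T x $ i - S x $ i)\<^sup>2) \<partial>R)"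
    using c by (subst nn_integral_distr) (simp_all add: sq)
  also have "\<dots> \<le> ennreal B" by (rule le)
  finally have "enn2real ?W \<le> B" by (rule enn2real_leI[OF \<open>0 \<le> B\<close>])
  then show ?thesis by (simp add: wasserstein_def powr_half_sqrt)
qed

section \<open>Maxima of affine functions\<close>

lemma max_affine_ge: "k \<in> {1..n} \<Longrightarrow> q k \<bullet> x - p k \<le> max_affine n q p x"
  unfolding max_affine_def by (intro Max_ge) auto

lemma max_affine_attained:
  assumes "1 \<le> n"
  shows "\<exists>k\<in>{1..n}. max_affine n q p x = q k \<bullet> x - p k"
proof -
  have "max_affine n q p x \<in> (\<lambda>k. q k \<bullet> x - p k) ` {1..n}"
    unfolding max_affine_def using assms by (intro Max_in) auto
  then show ?thesis by auto
qed

lemma max_affine_shift: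
  assumes "1 \<le> n"
  shows "max_affine n q (\<lambda>k. p k - c) x = max_affine n q p x + c"
proof (rule antisym)
  obtain k where "k \<in> {1..n}" "max_affine n q (\<lambda>k. p k - c) x = q k \<bullet> x - (p k - c)"
    using max_affine_attained[OF assms, of q "\<lambda>k. p k - c" x] by blast
  then show "max_affine n q (\<lambda>k. p k - c) x \<le> max_affine n q p x + c"
    using max_affine_ge[of k n q x p] by simp
next
  obtain k where "k \<in> {1..n}" "max_affine n q p x = q k \<bullet> x - p k"
    using max_affine_attained[OF assms, of q p x] by blast
  then show "max_affine n q p x + c \<le> max_affine n q (\<lambda>k. p k - c) x"
    using max_affine_ge[of k n q x "\<lambda>k. p k - c"] by simp
qed

lemma convex_on_max_affine:
  fixes q :: "nat \<Rightarrow> real^'d"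
  assumes "1 \<le> n"
  shows "convex_on UNIV (max_affine n q p)"
proof (rule convex_onI)
  fix t :: real and x y :: "real^'d" assume t: "0 < t" "t < 1"
  obtain k where k: "k \<in> {1..n}"
    "max_affine n q p ((1 - t) *\<^sub>R x + t *\<^sub>R y) = q k \<bullet> ((1 - t) *\<^sub>R x + t *\<^sub>R y) - p k"
    using max_affine_attained[OF assms, of q p] by blast
  have "(1 - t) * (q k \<bullet> x - p k) \<le> (1 - t) * max_affine n q p x"
    "t * (q k \<bullet> y - p k) \<le> t * max_affine n q p y"
    using t max_affine_ge[OF k(1)] by (auto intro: mult_left_mono)
  then show "max_affine n q p ((1 - t) *\<^sub>R x + t *\<^sub>R y) \<le> (1 - t) * max_affine n q p x + t * max_affine n q p y"
    unfolding k(2) by (simp add: inner_add_right algebra_simps)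
qed simp

lemma measurable_max_affine [measurable]:
  assumes "1 \<le> n"
  shows "max_affine n q p \<in> borel_measurable borel"
  using continuous_on_convex_UNIV[OF convex_on_max_affine[OF assms]]
  by (rule borel_measurable_continuous_onI)

text \<open>Choosing the least index at which the maximum is attained makes the slope a Borel function of the
point.\<close>
lemma max_affine_gradient:
  assumes "1 \<le> n"
  obtains S where "S \<in> borel_measurable borel" "range S \<subseteq> q ` {1..n}"
    "\<And>x. S x \<in> subgradients (max_affine n q p) x"
proof -
  define \<kappa> where "\<kappa> x = (LEAST k. k \<in> {1..n} \<and> max_affine n q p x = q k \<bullet> x - p k)" for x
  have \<kappa>: "\<kappa> x \<in> {1..n} \<and> max_affine n q p x = q (\<kappa> x) \<bullet> x - p (\<kappa> x)" for x
    unfolding \<kappa>_def by (rule LeastI_ex) (use max_affine_attained[OF assms, of q p x] in blast)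
  have [measurable]: "max_affine n q p \<in> borel_measurable borel"
    by (rule measurable_max_affine[OF assms])
  have "\<kappa> \<in> measurable borel (count_space UNIV)"
    unfolding \<kappa>_def by measurable
  then have "(\<lambda>x. q (\<kappa> x)) \<in> borel_measurable borel"
    by (rule measurable_compose) simp
  moreover have "q (\<kappa> x) \<in> subgradients (max_affine n q p) x" for x
    unfolding subgradients_def
  proof (intro CollectI allI)
    fix z
    show "max_affine n q p x + q (\<kappa> x) \<bullet> (z - x) \<le> max_affine n q p z"
      using \<kappa>[of x] max_affine_ge[of "\<kappa> x" n q z p] by (simp add: inner_diff_right)
  qed
  ultimately show ?thesis using that[of "\<lambda>x. q (\<kappa> x)"] \<kappa> by blast
qed

text \<open>Repetitions are allowed, which is how a measure with fewer than \<open>n\<close> atoms provides \<open>n\<close> slopes.\<close>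
lemma finite_enumeration:
  assumes "finite A" "A \<noteq> {}" "card A \<le> n"
  shows "\<exists>q. q ` {1..n} = A"
proof -
  obtain f where f: "f ` A \<subseteq> {1..n}" "inj_on f A"
    using card_le_inj[of A "{1..n}"] assms by auto
  obtain a where a: "a \<in> A" using assms by blast
  let ?q = "\<lambda>k. if k \<in> f ` A then inv_into A f k else a"
  have "?q ` {1..n} = A"
  proof (intro equalityI subsetI)
    fix x assume "x \<in> A"
    then have *: "?q (f x) = x" "f x \<in> {1..n}" using f by auto
    show "x \<in> ?q ` {1..n}" by (rule image_eqI[where f = ?q, OF *(1)[symmetric] *(2)])
  next
    fix x assume "x \<in> ?q ` {1..n}"
    then obtain k where "x = ?q k" by blast
    then show "x \<in> A" using a inv_into_into[of k f A] by (cases "k \<in> f ` A") simp_all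
  qed
  then show ?thesis by blast
qed

section \<open>Elementary estimates\<close>

text \<open>The choice \<open>\<delta> = w\<^sup>2 / (2 D)\<close> lets the term \<open>D * \<delta>\<close> absorb half of the left-hand side.\<close>
lemma cube_le_of_quadratic_bound:
  fixes w F D :: real
  assumes "0 \<le> w" "0 \<le> F" "0 < D" and le: "\<And>\<delta>. 0 < \<delta> \<Longrightarrow> w\<^sup>2 \<le> D * (F / \<delta>\<^sup>2 + \<delta>)"
  shows "w ^ 3 \<le> sqrt (8 * D ^ 3) * sqrt F"
proof (cases "w = 0")
  case False
  then have w: "0 < w" using assms by simp
  define \<delta> where "\<delta> = w\<^sup>2 / (2 * D)"
  have \<delta>: "0 < \<delta>" using w assms by (simp add: \<delta>_def)
  have "D * \<delta> = w\<^sup>2 / 2" using assms by (simp add: \<delta>_def)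
  moreover have "w\<^sup>2 \<le> D * (F / \<delta>\<^sup>2) + D * \<delta>" using le[OF \<delta>] by (simp add: distrib_left)
  ultimately have "w\<^sup>2 / 2 \<le> D * (F / \<delta>\<^sup>2)" by linarith
  then have "w\<^sup>2 / 2 * \<delta>\<^sup>2 \<le> D * F" using \<delta> by (simp add: field_simps)
  also have "w\<^sup>2 / 2 * \<delta>\<^sup>2 = (w ^ 3)\<^sup>2 / (8 * D\<^sup>2)"
    by (simp add: \<delta>_def power2_eq_square power3_eq_cube)
  finally have "(w ^ 3)\<^sup>2 \<le> D * F * (8 * D\<^sup>2)" using assms by (simp add: divide_le_eq)
  also have "\<dots> = 8 * D ^ 3 * F" by (simp add: power2_eq_square power3_eq_cube)
  finally have "w ^ 3 \<le> sqrt (8 * D ^ 3 * F)" by (rule real_le_rsqrt)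
  then show ?thesis by (simp add: real_sqrt_mult)
qed (use assms in simp)

text \<open>Centering lowers the second moment, and \<open>f\<^sup>2 \<le> K f\<close>. This trades the \<open>L\<^sup>2\<close> norm for the square
root of the \<open>L\<^sup>1\<close> norm, which is the source of the exponent in the upper bound.\<close>
lemma mean_zero_second_moment_le:
  fixes f :: "'a \<Rightarrow> real"
  assumes "prob_space R" and f: "integrable R f" and f2: "integrable R (\<lambda>x. (f x)\<^sup>2)"
    and bd: "AE x in R. 0 \<le> f x \<and> f x \<le> K"
  shows "(\<integral>x. (f x - (\<integral>x. f x \<partial>R))\<^sup>2 \<partial>R) \<le> K * (\<integral>x. f x \<partial>R)"
proof -
  interpret prob_space R by fact
  let ?c = "\<integral>x. f x \<partial>R"
  have "(\<integral>x. (f x - ?c)\<^sup>2 \<partial>R) = (\<integral>x. (f x)\<^sup>2 - 2 * ?c * f x + ?c\<^sup>2 \<partial>R)"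
    by (intro Bochner_Integration.integral_cong) (auto simp: power2_diff algebra_simps)
  also have "\<dots> = (\<integral>x. (f x)\<^sup>2 \<partial>R) - 2 * ?c * ?c + ?c\<^sup>2"
    using f f2 by (simp add: prob_space)
  also have "\<dots> \<le> (\<integral>x. (f x)\<^sup>2 \<partial>R)" by (simp add: power2_eq_square)
  also have "\<dots> \<le> (\<integral>x. K * f x \<partial>R)"
    using f f2 bd by (intro integral_mono_AE) (auto simp: power2_eq_square intro: mult_right_mono)
  finally show ?thesis by simp
qed

section \<open>The two bounds for a density on a compact convex set\<close>

locale bounded_density =
  fixes X Q :: "(real^'d) set" and \<rho> :: "real^'d \<Rightarrow> real" and a b r L :: real
  assumes X: "compact X" "convex X" and Q: "compact Q"
    and \<rho>: "\<rho> \<in> borel_measurable borel" "\<And>x. 0 \<le> \<rho> x"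
    and prob: "density lborel (\<lambda>x. ennreal (\<rho> x)) \<in> prob_measures_on X"
    and ab: "0 < a" "0 < b" "AE x in lborel. x \<in> X \<longrightarrow> a \<le> \<rho> x \<and> \<rho> x \<le> b"
    and r: "0 < r" "\<And>x. x \<in> X \<Longrightarrow> norm x \<le> r"
    and L: "0 < L" "\<And>y. y \<in> Q \<Longrightarrow> norm y \<le> L"
begin

definition R :: "(real^'d) measure" where "R = density lborel (\<lambda>x. ennreal (\<rho> x))"

sublocale R: prob_space R
  using prob by (simp add: prob_measures_on_def R_def)

lemma sets_R [measurable_cong, simp]: "sets R = sets borel"
  by (simp add: R_def)

lemma space_R [simp]: "space R = UNIV"
  by (simp add: R_def)

lemma measure_R_UNIV [simp]: "measure R UNIV = 1"
  using R.prob_space by simp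

lemma sets_XQ [measurable]: "X \<in> sets borel" "Q \<in> sets borel"
  using X Q by (auto simp: borel_closed compact_imp_closed)

lemma AE_R_X: "AE x in R. x \<in> X"
  unfolding R_def by (rule AE_prob_measures_on[OF prob])

text \<open>The two-sided bound on the density makes \<open>R\<close> and Lebesgue measure on \<open>X\<close> have the same null sets.\<close>
lemma AE_R_iff: "(AE x in R. P x) \<longleftrightarrow> (AE x in lborel. x \<in> X \<longrightarrow> P x)"
proof -
  have density: "(AE x in R. P x) \<longleftrightarrow> (AE x in lborel. 0 < ennreal (\<rho> x) \<longrightarrow> P x)" for P
    unfolding R_def using \<rho> by (intro AE_density) auto
  have X: "AE x in lborel. 0 < ennreal (\<rho> x) \<longleftrightarrow> x \<in> X"
    using ab(3) AE_R_X[unfolded density] by eventually_elim (use ab(1) in auto)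
  show ?thesis
    unfolding density using X by (intro eventually_subst) (auto elim: eventually_mono)
qed

lemma nn_integral_R_le:
  assumes [measurable]: "g \<in> borel_measurable borel"
  shows "(\<integral>\<^sup>+x. g x \<partial>R) \<le> ennreal b * (\<integral>\<^sup>+x. indicator X x * g x \<partial>lborel)"
proof -
  have "(\<integral>\<^sup>+x. g x \<partial>R) = (\<integral>\<^sup>+x. indicator X x * g x \<partial>R)"
    using AE_R_X by (intro nn_integral_cong_AE) (auto elim!: eventually_mono)
  also have "\<dots> = (\<integral>\<^sup>+x. ennreal (\<rho> x) * (indicator X x * g x) \<partial>lborel)"
    unfolding R_def using \<rho> by (intro nn_integral_density) auto
  also have "\<dots> \<le> (\<integral>\<^sup>+x. ennreal b * (indicator X x * g x) \<partial>lborel)"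
    using ab(3) by (intro nn_integral_mono_AE)
      (auto elim!: eventually_mono simp: indicator_def intro!: mult_right_mono ennreal_leI)
  also have "\<dots> = ennreal b * (\<integral>\<^sup>+x. indicator X x * g x \<partial>lborel)"
    by (intro nn_integral_cmult) auto
  finally show ?thesis .
qed

lemma nn_integral_lborel_le:
  assumes [measurable]: "g \<in> borel_measurable borel"
  shows "(\<integral>\<^sup>+x. indicator X x * g x \<partial>lborel) \<le> ennreal (1 / a) * (\<integral>\<^sup>+x. g x \<partial>R)"
proof -
  have "(\<integral>\<^sup>+x. indicator X x * g x \<partial>lborel) \<le> (\<integral>\<^sup>+x. ennreal (1 / a) * (ennreal (\<rho> x) * g x) \<partial>lborel)"
  proof (rule nn_integral_mono_AE)
    show "AE x in lborel. indicator X x * g x \<le> ennreal (1 / a) * (ennreal (\<rho> x) * g x)"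
      using ab(3)
    proof eventually_elim
      case (elim x)
      show ?case
      proof (cases "x \<in> X")
        case True
        then have "1 \<le> ennreal (1 / a) * ennreal (\<rho> x)"
          using elim ab(1) \<rho>(2)[of x] by (simp add: ennreal_mult[symmetric] ennreal_ge_1)
        from mult_right_mono[OF this, of "g x"] show ?thesis using True by (simp add: mult.assoc)
      qed simp
    qed
  qed
  also have "\<dots> = ennreal (1 / a) * (\<integral>\<^sup>+x. g x \<partial>R)"
    unfolding R_def using \<rho> by (subst nn_integral_density) (auto simp: nn_integral_cmult)
  finally show ?thesis .
qed

lemma set_integral_eq_R:
  assumes [measurable]: "h \<in> borel_measurable borel"
  shows "(LINT x:X|lborel. h x * \<rho> x) = (\<integral>x. h x \<partial>R)"
proof -
  have "(\<integral>x. h x \<partial>R) = (\<integral>x. indicator X x *\<^sub>R h x \<partial>R)"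
    using AE_R_X by (intro integral_cong_AE) (auto elim!: eventually_mono)
  also have "\<dots> = (LINT x:X|lborel. h x * \<rho> x)"
    unfolding R_def set_lebesgue_integral_def using \<rho>
    by (subst integral_density) (auto intro!: Bochner_Integration.integral_cong)
  finally show ?thesis by simp
qed

lemma integrable_R_continuous:
  fixes h :: "real^'d \<Rightarrow> real"
  assumes "continuous_on UNIV h"
  shows "integrable R h"
proof -
  have "compact (h ` X)"
    using X(1) continuous_on_subset[OF assms, of X] by (intro compact_continuous_image) auto
  then obtain B where B: "\<And>x. x \<in> X \<Longrightarrow> norm (h x) \<le> B"
    using compact_imp_bounded[of "h ` X"] by (auto simp: bounded_iff)
  show ?thesis
  proof (rule R.integrable_const_bound)
    show "AE x in R. norm (h x) \<le> B" using AE_R_X by eventually_elim (rule B)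
    show "h \<in> borel_measurable R"
      using borel_measurable_continuous_onI[OF assms] by simp
  qed
qed

lemma val_polyhedral_eq:
  assumes u: "convex_on UNIV u" and n: "1 \<le> n"
  shows "val_polyhedral n X \<rho> Q u = Inf {sqrt (\<integral>x. (u x - max_affine n q p x)\<^sup>2 \<partial>R) | q p.
       (\<forall>k\<in>{1..n}. q k \<in> Q) \<and> (\<integral>x. (u x - max_affine n q p x) \<partial>R) = 0}"
proof -
  have [measurable]: "u \<in> borel_measurable borel"
    by (rule borel_measurable_continuous_onI[OF continuous_on_convex_UNIV[OF u]])
  have [measurable]: "max_affine n q p \<in> borel_measurable borel" for q :: "nat \<Rightarrow> real^'d" and p
    by (rule measurable_max_affine[OF n])
  have "(LINT x:X|lborel. (u x - max_affine n q p x)\<^sup>2 * \<rho> x) = (\<integral>x. (u x - max_affine n q p x)\<^sup>2 \<partial>R)"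
    "(LINT x:X|lborel. (u x - max_affine n q p x) * \<rho> x) = (\<integral>x. u x - max_affine n q p x \<partial>R)" for q p
    by (rule set_integral_eq_R; measurable)+
  then show ?thesis unfolding val_polyhedral_def by simp
qed

text \<open>A single affine function, shifted to have the right mean, is feasible. Without a feasible point the
infimum over the empty set of reals would carry no information.\<close>
lemma polyhedral_feasible:
  assumes u: "convex_on UNIV u" and n: "1 \<le> n" and "Q \<noteq> {}"
  shows "\<exists>q p. (\<forall>k\<in>{1..n}. q k \<in> Q) \<and> (\<integral>x. (u x - max_affine n q p x) \<partial>R) = 0"
proof -
  obtain q0 where q0: "q0 \<in> Q" using \<open>Q \<noteq> {}\<close> by blast
  define c where "c = (\<integral>x. u x - max_affine n (\<lambda>_. q0) (\<lambda>_. 0) x \<partial>R)"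
  have i: "integrable R (\<lambda>x. u x - max_affine n (\<lambda>_. q0) (\<lambda>_. 0) x)"
    by (intro integrable_R_continuous continuous_intros continuous_on_convex_UNIV u convex_on_max_affine[OF n])
  have "(\<integral>x. (u x - max_affine n (\<lambda>_. q0) (\<lambda>k. 0 - c) x) \<partial>R)
      = (\<integral>x. (u x - max_affine n (\<lambda>_. q0) (\<lambda>_. 0) x) - c \<partial>R)"
    unfolding max_affine_shift[OF n] by (simp add: algebra_simps)
  also have "\<dots> = 0" using i by (simp add: c_def)
  finally show ?thesis
    using q0 by (intro exI[of _ "\<lambda>_. q0"] exI[of _ "\<lambda>k. 0 - c"]) auto
qed

text \<open>The points with a subgradient in \<open>Q\<close> form a closed set of full measure. A closed set of full
measure in \<open>X\<close> contains the interior of \<open>X\<close>, as nonempty open sets are not null, and hence its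
closure, which is \<open>X\<close> because a convex set that is not null has nonempty interior.\<close>
lemma subgradient_in_Q:
  assumes u: "convex_on UNIV u"
    and T: "range T \<subseteq> Q" "AE x in R. T x \<in> subgradients u x" and x: "x \<in> X"
  shows "\<exists>y\<in>Q. y \<in> subgradients u x"
proof -
  define P where "P = {x. \<exists>y\<in>Q. y \<in> subgradients u x}"
  have "closed P" unfolding P_def by (rule closed_subgradient_preimage[OF u Q])
  have PX: "AE x in lborel. x \<in> X \<longrightarrow> x \<in> P"
    using T(2) unfolding AE_R_iff by eventually_elim (use T(1) in \<open>auto simp: P_def\<close>)
  have not_neg: "\<not> negligible X"
  proof
    assume "negligible X"
    then have "X \<in> null_sets lborel"
      using sets_XQ(1) by (auto simp: negligible_iff_null_sets null_sets_completion_iff)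
    then have "AE x in R. False"
      unfolding AE_R_iff using AE_not_in by (auto elim: eventually_mono)
    then show False by (simp add: R.AE_False)
  qed
  have "negligible (interior X - P)"
  proof -
    have "AE x in lborel. x \<notin> interior X - P"
      using PX by eventually_elim (use interior_subset[of X] in auto)
    moreover have "interior X - P \<in> sets borel" using \<open>closed P\<close> by (auto intro: borel_open borel_closed)
    ultimately show ?thesis
      by (subst (asm) AE_iff_null_sets[symmetric])
        (auto simp: negligible_iff_null_sets intro: null_sets_completionI)
  qed
  moreover have "open (interior X - P)" using \<open>closed P\<close> by (intro open_Diff) auto
  ultimately have "interior X \<subseteq> P" using open_not_negligible by blast
  then have "closure (interior X) \<subseteq> P" using \<open>closed P\<close> by (rule closure_minimal)
  moreover have "closure (interior X) = X"
    using convex_closure_interior[OF X(2)] negligible_convex_interior[OF X(2)] not_neg X(1)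
    by (auto simp: compact_imp_closed)
  ultimately show ?thesis using x by (auto simp: P_def)
qed

text \<open>The factors \<open>b\<close> and \<open>1 / a\<close> come from passing between \<open>R\<close> and Lebesgue measure, the dimension
from summing over coordinates, and the volume of the ball from integrating the term \<open>\<delta>\<close> over all
base points of unit segments that meet \<open>X\<close>.\<close>
definition lower_const :: real where
  "lower_const = real CARD('d) * (b * ((128 * L\<^sup>2 + 8 * L) * (1 / a + measure lborel (cball 0 (r + 1) :: (real^'d) set))))"

lemma lower_const_pos: "0 < lower_const"
  unfolding lower_const_def using ab L by (intro mult_pos_pos add_pos_nonneg) auto

text \<open>The coordinates of the gradients are treated one at a time, each along its own direction. Unit
segments that meet \<open>X\<close> start in the ball of radius \<open>r + 1\<close>.\<close>
lemma nn_integral_gradient_difference_R_le: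
  assumes u: "convex_on UNIV u" and v: "convex_on UNIV v" and \<delta>: "0 < \<delta>"
    and T: "T \<in> borel_measurable borel" "range T \<subseteq> Q" "AE x in R. T x \<in> subgradients u x"
    and S: "S \<in> borel_measurable borel" "range S \<subseteq> Q" "\<And>x. S x \<in> subgradients v x"
  shows "(\<integral>\<^sup>+x. ennreal (\<Sum>i\<in>UNIV. (T x $ i - S x $ i)\<^sup>2) \<partial>R)
    \<le> ennreal (lower_const * ((\<integral>x. (u x - v x)\<^sup>2 \<partial>R) / \<delta>\<^sup>2 + \<delta>))"
proof -
  have cont: "continuous_on UNIV u" "continuous_on UNIV v"
    using u v by (auto intro: continuous_on_convex_UNIV)
  have [measurable]: "u \<in> borel_measurable borel" "v \<in> borel_measurable borel"
    using cont by (auto intro: borel_measurable_continuous_onI)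
  note [measurable] = T(1) S(1)
  have [measurable]: "(\<lambda>x. T x $ i) \<in> borel_measurable borel" "(\<lambda>x. S x $ i) \<in> borel_measurable borel" for i
    by (rule measurable_compose[OF T(1)], intro borel_measurable_continuous_onI continuous_intros)
      (rule measurable_compose[OF S(1)], intro borel_measurable_continuous_onI continuous_intros)
  define F where "F = (\<integral>x. (u x - v x)\<^sup>2 \<partial>R)"
  define \<beta> where "\<beta> = measure lborel (cball 0 (r + 1) :: (real^'d) set)"
  let ?C = "128 * L\<^sup>2 + 8 * L"
  have F0: "0 \<le> F" unfolding F_def by (rule integral_nonneg_AE) simp
  have nnF: "(\<integral>\<^sup>+x. ennreal ((u x - v x)\<^sup>2) \<partial>R) = ennreal F"
    unfolding F_def by (intro nn_integral_eq_integral integrable_R_continuous continuous_intros cont) auto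
  have \<beta>: "emeasure lborel (cball 0 (r + 1) :: (real^'d) set) = ennreal \<beta>"
    using emeasure_lborel_cball_finite[of "0 :: real^'d" "r + 1"]
    unfolding \<beta>_def by (intro emeasure_eq_ennreal_measure) auto
  have coord: "(\<integral>\<^sup>+x. ennreal ((T x $ i - S x $ i)\<^sup>2) \<partial>R) \<le> ennreal (b * (?C * ((1 / a + \<beta>) * (F / \<delta>\<^sup>2 + \<delta>))))" for i
  proof -
    let ?e = "axis i 1 :: real^'d"
    have bound: "\<bar>y \<bullet> ?e\<bar> \<le> L" if "y \<in> Q" for y
      using Cauchy_Schwarz_ineq2[of y ?e] L(2)[OF that] by (simp add: norm_axis_1)
    have fun_le: "(\<integral>\<^sup>+x. indicator X x * ennreal ((u x - v x)\<^sup>2) \<partial>lborel) \<le> ennreal (1 / a) * ennreal F"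
      using nn_integral_lborel_le[of "\<lambda>x. ennreal ((u x - v x)\<^sup>2)"] by (simp add: nnF)
    have grad_le: "(\<integral>\<^sup>+x. indicator X x * ennreal (((T x - S x) \<bullet> ?e)\<^sup>2) \<partial>lborel)
        \<le> ennreal ?C * (ennreal (1 / a) * ennreal F * ennreal (1 / \<delta>\<^sup>2)
          + ennreal \<delta> * emeasure lborel (cball 0 (r + 1) :: (real^'d) set))"
    proof -
      have "(\<integral>\<^sup>+x. indicator X x * ennreal (((T x - S x) \<bullet> ?e)\<^sup>2) \<partial>lborel)
          \<le> ennreal ?C * ((\<integral>\<^sup>+x. indicator X x * ennreal ((u x - v x)\<^sup>2) \<partial>lborel) * ennreal (1 / \<delta>\<^sup>2)
            + ennreal \<delta> * emeasure lborel (cball 0 (r + 1) :: (real^'d) set))"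
      proof (rule nn_integral_gradient_difference_le[OF X L(1) \<delta> u v _ _ T(1) S(1)])
        show "\<exists>y\<in>subgradients u x. \<bar>y \<bullet> ?e\<bar> \<le> L" if "x \<in> X" for x
          using subgradient_in_Q[OF u T(2,3) that] bound by blast
        show "\<exists>y\<in>subgradients v x. \<bar>y \<bullet> ?e\<bar> \<le> L" for x
          using S(2,3) bound by blast
        show "AE x in lborel. x \<in> X \<longrightarrow> T x \<in> subgradients u x" using T(3) by (simp add: AE_R_iff)
        show "x \<in> cball 0 (r + 1)" if "t \<in> {0..1}" "x + t *\<^sub>R ?e \<in> X" for x t
        proof -
          have "norm x \<le> norm (x + t *\<^sub>R ?e) + norm (t *\<^sub>R ?e)"
            using norm_triangle_ineq4[of "x + t *\<^sub>R ?e" "t *\<^sub>R ?e"] by simp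
          then show ?thesis using r(2)[OF that(2)] that(1) by (simp add: norm_axis_1)
        qed
      qed (use S in auto)
      also have "\<dots> \<le> ennreal ?C * (ennreal (1 / a) * ennreal F * ennreal (1 / \<delta>\<^sup>2)
          + ennreal \<delta> * emeasure lborel (cball 0 (r + 1) :: (real^'d) set))"
        by (intro mult_left_mono add_right_mono mult_right_mono fun_le) simp_all
      finally show ?thesis .
    qed
    have "(\<integral>\<^sup>+x. ennreal ((T x $ i - S x $ i)\<^sup>2) \<partial>R)
        = (\<integral>\<^sup>+x. ennreal (((T x - S x) \<bullet> ?e)\<^sup>2) \<partial>R)"
      by (simp add: inner_axis)
    also have "\<dots> \<le> ennreal b * (\<integral>\<^sup>+x. indicator X x * ennreal (((T x - S x) \<bullet> ?e)\<^sup>2) \<partial>lborel)"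
      by (rule nn_integral_R_le) measurable
    also have "\<dots> \<le> ennreal b * (ennreal ?C * (ennreal (1 / a) * ennreal F * ennreal (1 / \<delta>\<^sup>2)
          + ennreal \<delta> * emeasure lborel (cball 0 (r + 1) :: (real^'d) set)))"
      by (rule mult_left_mono[OF grad_le]) simp
    also have "\<dots> = ennreal (b * (?C * (1 / a * F * (1 / \<delta>\<^sup>2) + \<delta> * \<beta>)))"
      unfolding \<beta> using ab L F0 \<delta>
      by (simp add: ennreal_mult[symmetric] ennreal_plus[symmetric] \<beta>_def del: ennreal_plus)
    also have "\<dots> \<le> ennreal (b * (?C * ((1 / a + \<beta>) * (F / \<delta>\<^sup>2 + \<delta>))))"
    proof (intro ennreal_leI mult_left_mono)
      have "0 \<le> 1 / a * \<delta> + \<beta> * (F / \<delta>\<^sup>2)" using ab F0 \<delta> by (simp add: \<beta>_def)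
      moreover have "(1 / a + \<beta>) * (F / \<delta>\<^sup>2 + \<delta>)
          = 1 / a * F * (1 / \<delta>\<^sup>2) + \<delta> * \<beta> + (1 / a * \<delta> + \<beta> * (F / \<delta>\<^sup>2))"
        by (simp add: distrib_left distrib_right mult.commute add_divide_distrib)
      ultimately show "1 / a * F * (1 / \<delta>\<^sup>2) + \<delta> * \<beta> \<le> (1 / a + \<beta>) * (F / \<delta>\<^sup>2 + \<delta>)"
        by linarith
    qed (use ab L in auto)
    finally show ?thesis .
  qed
  have "(\<integral>\<^sup>+x. ennreal (\<Sum>i\<in>UNIV. (T x $ i - S x $ i)\<^sup>2) \<partial>R)
      = (\<integral>\<^sup>+x. (\<Sum>i\<in>UNIV. ennreal ((T x $ i - S x $ i)\<^sup>2)) \<partial>R)"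
    by (intro nn_integral_cong sum_ennreal[symmetric]) auto
  also have "\<dots> = (\<Sum>i\<in>UNIV. \<integral>\<^sup>+x. ennreal ((T x $ i - S x $ i)\<^sup>2) \<partial>R)"
    by (rule nn_integral_sum) measurable
  also have "\<dots> \<le> of_nat CARD('d) * ennreal (b * (?C * ((1 / a + \<beta>) * (F / \<delta>\<^sup>2 + \<delta>))))"
    by (rule sum_bounded_above[OF coord])
  also have "\<dots> = ennreal (lower_const * (F / \<delta>\<^sup>2 + \<delta>))"
    unfolding lower_const_def \<beta>_def[symmetric]
    using ab L F0 \<delta> by (simp add: ennreal_of_nat_eq_real_of_nat ennreal_mult[symmetric] \<beta>_def mult.assoc)
  finally show ?thesis unfolding F_def .
qed

text \<open>A feasible maximum of affine functions yields a competitor for the quantization problem, namely the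
image of \<open>R\<close> under its gradient, which charges at most its \<open>n\<close> slopes. Coupling it with \<open>\<mu>\<close>
through the two gradients bounds the Wasserstein distance by the \<open>L\<^sup>2\<close> distance of the
gradients, and the interpolation inequality bounds the latter by the distance of the functions.\<close>
lemma val_quantization_cube_le:
  assumes u: "convex_on UNIV u" and n: "1 \<le> n"
    and T: "T \<in> borel_measurable borel" "range T \<subseteq> Q" "AE x in R. T x \<in> subgradients u x"
  shows "1 / sqrt (8 * lower_const ^ 3) * (val_quantization n 2 Q (distr R borel T)) ^ 3 \<le> val_polyhedral n X \<rho> Q u"
  unfolding val_polyhedral_eq[OF u n]
proof (rule cInf_greatest)
  have "Q \<noteq> {}" using T(2) by auto
  show "{sqrt (\<integral>x. (u x - max_affine n q p x)\<^sup>2 \<partial>R) | q p.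
       (\<forall>k\<in>{1..n}. q k \<in> Q) \<and> (\<integral>x. (u x - max_affine n q p x) \<partial>R) = 0} \<noteq> {}"
    using polyhedral_feasible[OF u n \<open>Q \<noteq> {}\<close>] by blast
  fix e assume "e \<in> {sqrt (\<integral>x. (u x - max_affine n q p x)\<^sup>2 \<partial>R) | q p.
       (\<forall>k\<in>{1..n}. q k \<in> Q) \<and> (\<integral>x. (u x - max_affine n q p x) \<partial>R) = 0}"
  then obtain q p where q: "\<And>k. k \<in> {1..n} \<Longrightarrow> q k \<in> Q"
    and e: "e = sqrt (\<integral>x. (u x - max_affine n q p x)\<^sup>2 \<partial>R)" by blast
  define F where "F = (\<integral>x. (u x - max_affine n q p x)\<^sup>2 \<partial>R)"
  obtain S where S: "S \<in> borel_measurable borel" "range S \<subseteq> q ` {1..n}"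
    "\<And>x. S x \<in> subgradients (max_affine n q p) x"
    using max_affine_gradient[OF n] by blast
  have "q ` {1..n} \<subseteq> Q" by (rule image_subsetI) (rule q)
  with S(2) have SQ: "range S \<subseteq> Q" by (rule order_trans)
  have TSR: "T \<in> measurable R borel" "S \<in> measurable R borel" using T(1) S(1) by simp_all
  let ?\<nu> = "distr R borel S"
  have \<nu>: "?\<nu> \<in> prob_measures_on (q ` {1..n})"
    using TSR(2) S(2) by (intro prob_measures_on_distr R.prob_space_axioms) (auto intro: borel_closed finite_imp_closed)
  have \<nu>Q: "?\<nu> \<in> prob_measures_on Q"
    by (intro prob_measures_on_distr R.prob_space_axioms TSR SQ sets_XQ)
  have supp: "measure_support ?\<nu> \<subseteq> q ` {1..n}"
    by (rule measure_support_subset[OF \<nu>]) (auto intro: finite_imp_closed)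
  have fin: "finite (measure_support ?\<nu>)" using supp finite_subset by blast
  have "card (measure_support ?\<nu>) \<le> card (q ` {1..n})" by (rule card_mono[OF _ supp]) simp
  also have "\<dots> \<le> n" using card_image_le[of "{1..n}" q] by simp
  finally have card: "card (measure_support ?\<nu>) \<le> n" .
  define w where "w = wasserstein 2 (distr R borel T) ?\<nu>"
  have w0: "0 \<le> w" by (simp add: w_def wasserstein_nonneg)
  have F0: "0 \<le> F" unfolding F_def by (rule integral_nonneg_AE) simp
  have "val_quantization n 2 Q (distr R borel T) \<le> w"
    unfolding val_quantization_def w_def
    by (rule cInf_lower[OF _ quantization_bdd_below]) (use \<nu>Q fin card in blast)
  then have "(val_quantization n 2 Q (distr R borel T)) ^ 3 \<le> w ^ 3" by (intro power_mono_odd) auto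
  also have "\<dots> \<le> sqrt (8 * lower_const ^ 3) * sqrt F"
  proof (rule cube_le_of_quadratic_bound[OF w0 F0 lower_const_pos])
    fix \<delta> :: real assume \<delta>: "0 < \<delta>"
    show "w\<^sup>2 \<le> lower_const * (F / \<delta>\<^sup>2 + \<delta>)"
      unfolding w_def
    proof (rule wasserstein_two_square_le[OF R.prob_space_axioms TSR])
      show "(\<integral>\<^sup>+x. ennreal (\<Sum>i\<in>UNIV. (T x $ i - S x $ i)\<^sup>2) \<partial>R) \<le> ennreal (lower_const * (F / \<delta>\<^sup>2 + \<delta>))"
        unfolding F_def
        by (rule nn_integral_gradient_difference_R_le[OF u convex_on_max_affine[OF n] \<delta> T S(1) SQ S(3)])
      show "0 \<le> lower_const * (F / \<delta>\<^sup>2 + \<delta>)" using lower_const_pos F0 \<delta> by simp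
    qed
  qed
  finally show "1 / sqrt (8 * lower_const ^ 3) * (val_quantization n 2 Q (distr R borel T)) ^ 3 \<le> e"
    unfolding e F_def[symmetric] using lower_const_pos by (simp add: field_simps)
qed

text \<open>The atoms of \<open>N\<close> serve as slopes, each with the offset that makes the affine function touch \<open>u\<close>
from below on \<open>X\<close>; the offsets are values of the conjugate \<open>\<phi>\<close> of \<open>u\<close> restricted to \<open>X\<close>. Unlike
\<open>u\<^sup>*\<close>, the function \<open>\<phi>\<close> is finite and \<open>r\<close>-Lipschitz everywhere. Hence at a point with gradient
\<open>T x\<close> the gap between \<open>u\<close> and the maximum is at most \<open>2 r\<close> times the distance from \<open>T x\<close> to
the nearest atom, and the mean gap \<open>c\<close> is at most \<open>2 r\<close> times the Wasserstein distance. Adding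
\<open>c\<close> to the maximum restores the constraint on the mean.\<close>
lemma val_polyhedral_le_wasserstein:
  assumes u: "convex_on UNIV u" and n: "1 \<le> n"
    and T: "T \<in> borel_measurable borel" "range T \<subseteq> Q" "AE x in R. T x \<in> subgradients u x"
    and N: "N \<in> prob_measures_on Q" "finite (measure_support N)" "card (measure_support N) \<le> n"
  shows "val_polyhedral n X \<rho> Q u \<le> sqrt (8 * r\<^sup>2 * L) * sqrt (wasserstein 1 (distr R borel T) N)"
proof -
  let ?A = "measure_support N"
  let ?W = "wasserstein 1 (distr R borel T) N"
  have cu: "continuous_on S u" for S by (rule continuous_on_convex_UNIV[OF u])
  have AQ: "?A \<subseteq> Q" by (rule measure_support_subset[OF N(1) compact_imp_closed[OF Q]])
  have "?A \<noteq> {}"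
  proof
    assume "?A = {}"
    then have "AE x in N. False" using AE_measure_support[of N] N(1) by (simp add: prob_measures_on_def)
    then show False using N(1) prob_space.AE_False[of N] by (simp add: prob_measures_on_def)
  qed
  then obtain q where q: "q ` {1..n} = ?A" using finite_enumeration[OF N(2) _ N(3)] by blast
  define \<phi> where "\<phi> y = (SUP x\<in>X. y \<bullet> x - u x)" for y
  have bdd: "bdd_above ((\<lambda>x. y \<bullet> x - u x) ` X)" for y
    by (intro bounded_imp_bdd_above compact_imp_bounded compact_continuous_image continuous_intros cu X)
  define v where "v = max_affine n q (\<lambda>k. \<phi> (q k))"
  define f where "f x = u x - v x" for x
  define m where "m y = (MIN s\<in>?A. \<Sum>i\<in>UNIV. \<bar>y $ i - s $ i\<bar>)" for y
  have f_nonneg: "0 \<le> f x" if "x \<in> X" for x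
  proof -
    obtain k where "v x = q k \<bullet> x - \<phi> (q k)"
      using max_affine_attained[OF n, of q] unfolding v_def by blast
    moreover have "q k \<bullet> x - u x \<le> \<phi> (q k)"
      unfolding \<phi>_def by (rule cSUP_upper[OF that bdd])
    ultimately show ?thesis by (simp add: f_def)
  qed
  have f_le: "f x \<le> 2 * r * norm (s - T x)"
    if x: "x \<in> X" "T x \<in> subgradients u x" and s: "s \<in> ?A" for x s
  proof -
    obtain k where k: "k \<in> {1..n}" "s = q k" using s q by blast
    \<comment> \<open>The Lipschitz bound for \<open>\<phi>\<close>, as the conjugate equals \<open>T x \<bullet> x - u x\<close> at the subgradient \<open>T x\<close>.\<close>
    have "\<phi> s \<le> T x \<bullet> x - u x + r * norm (s - T x)"
      unfolding \<phi>_def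
    proof (rule cSUP_least)
      fix z assume z: "z \<in> X"
      have "(s - T x) \<bullet> z \<le> norm (s - T x) * norm z" by (rule norm_cauchy_schwarz)
      also have "\<dots> \<le> norm (s - T x) * r" using r(2)[OF z] by (intro mult_left_mono) auto
      finally have "(s - T x) \<bullet> z \<le> r * norm (s - T x)" by (simp add: mult.commute)
      moreover have "u x + T x \<bullet> (z - x) \<le> u z" using x(2) by (simp add: subgradients_def)
      ultimately show "s \<bullet> z - u z \<le> T x \<bullet> x - u x + r * norm (s - T x)"
        by (simp add: inner_diff_left inner_diff_right)
    qed (use x in blast)
    moreover have "s \<bullet> x - \<phi> s \<le> v x" unfolding v_def k(2) by (rule max_affine_ge[OF k(1)])
    moreover have "(T x - s) \<bullet> x \<le> norm (s - T x) * r"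
    proof -
      have "(T x - s) \<bullet> x \<le> norm (T x - s) * norm x" by (rule norm_cauchy_schwarz)
      also have "\<dots> \<le> norm (T x - s) * r" using r(2)[OF x(1)] by (intro mult_left_mono) auto
      finally show ?thesis by (simp add: norm_minus_commute)
    qed
    ultimately show ?thesis by (simp add: f_def inner_diff_left algebra_simps)
  qed
  have f_le_m: "f x \<le> 2 * r * m (T x)" if x: "x \<in> X" "T x \<in> subgradients u x" for x
  proof -
    have "m (T x) \<in> (\<lambda>s. \<Sum>i\<in>UNIV. \<bar>T x $ i - s $ i\<bar>) ` ?A"
      unfolding m_def using N(2) \<open>?A \<noteq> {}\<close> by (intro Min_in) auto
    then obtain s where s: "s \<in> ?A" "m (T x) = (\<Sum>i\<in>UNIV. \<bar>T x $ i - s $ i\<bar>)" by blast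
    have "norm (s - T x) \<le> m (T x)"
      using norm_le_l1_cart[of "T x - s"] s(2) by (simp add: norm_minus_commute)
    then have "2 * r * norm (s - T x) \<le> 2 * r * m (T x)" using r(1) by (intro mult_left_mono) auto
    then show ?thesis using f_le[OF x s(1)] by linarith
  qed
  have f_bound: "f x \<le> 4 * r * L" if x: "x \<in> X" "T x \<in> subgradients u x" for x
  proof -
    obtain s where s: "s \<in> ?A" using \<open>?A \<noteq> {}\<close> by blast
    have "norm (s - T x) \<le> norm s + norm (T x)" by (rule norm_triangle_ineq4)
    also have "\<dots> \<le> 2 * L" using L(2)[OF subsetD[OF AQ s]] L(2)[of "T x"] T(2) by fastforce
    finally have "2 * r * norm (s - T x) \<le> 2 * r * (2 * L)" using r(1) by (intro mult_left_mono) auto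
    then show ?thesis using f_le[OF x s] by linarith
  qed
  have AE_f: "AE x in R. 0 \<le> f x \<and> f x \<le> 4 * r * L" "AE x in R. f x \<le> 2 * r * m (T x)"
    using AE_R_X T(3) by (eventually_elim, use f_nonneg f_bound f_le_m in auto)+
  have cf: "continuous_on UNIV f"
    unfolding f_def v_def
    by (intro continuous_intros cu continuous_on_convex_UNIV convex_on_max_affine[OF n])
  have if1: "integrable R f" by (rule integrable_R_continuous[OF cf])
  have if2: "integrable R (\<lambda>x. (f x)\<^sup>2)" by (intro integrable_R_continuous continuous_intros cf)
  define c where "c = (\<integral>x. f x \<partial>R)"
  have m_meas [measurable]: "m \<in> borel_measurable borel"
    unfolding m_def using N(2) by (intro borel_measurable_Min) auto
  have m_le: "(\<integral>\<^sup>+x. ennreal (m (T x)) \<partial>R) \<le> ennreal ?W"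
  proof -
    have "(\<integral>\<^sup>+x. ennreal (m (T x)) \<partial>R) = (\<integral>\<^sup>+y. ennreal (m y) \<partial>distr R borel T)"
      using T(1) by (intro nn_integral_distr[symmetric]) auto
    also have "\<dots> \<le> ennreal ?W"
    proof (rule wasserstein_one_ge[OF _ N(1) L(2) m_meas])
      show "distr R borel T \<in> prob_measures_on Q"
        using T by (intro prob_measures_on_distr R.prob_space_axioms sets_XQ) auto
      show "m y \<le> (\<Sum>i\<in>UNIV. \<bar>y $ i - s $ i\<bar>)" if "s \<in> ?A" for y s
        unfolding m_def using that N(2) by (intro Min_le) auto
    qed
    finally show ?thesis .
  qed
  have c_le: "c \<le> 2 * r * ?W"
  proof -
    have "ennreal c = (\<integral>\<^sup>+x. ennreal (f x) \<partial>R)"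
      unfolding c_def by (rule nn_integral_eq_integral[symmetric, OF if1]) (use AE_f(1) in auto)
    also have "\<dots> \<le> (\<integral>\<^sup>+x. ennreal (2 * r) * ennreal (m (T x)) \<partial>R)"
      using AE_f(2) r(1) by (intro nn_integral_mono_AE) (auto elim!: eventually_mono simp: ennreal_mult'[symmetric] intro!: ennreal_leI)
    also have "\<dots> = ennreal (2 * r) * (\<integral>\<^sup>+x. ennreal (m (T x)) \<partial>R)"
      using T(1) by (intro nn_integral_cmult) auto
    also have "\<dots> \<le> ennreal (2 * r) * ennreal ?W" by (rule mult_left_mono[OF m_le]) simp
    also have "\<dots> = ennreal (2 * r * ?W)"
      using r(1) by (simp add: ennreal_mult wasserstein_nonneg)
    finally show ?thesis using r(1) by (simp add: ennreal_le_iff wasserstein_nonneg)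
  qed
  define p where "p k = \<phi> (q k) - c" for k
  have shift: "u x - max_affine n q p x = f x - c" for x
    unfolding p_def max_affine_shift[OF n] f_def v_def by simp
  have "val_polyhedral n X \<rho> Q u \<le> sqrt (\<integral>x. (f x - c)\<^sup>2 \<partial>R)"
    unfolding val_polyhedral_eq[OF u n]
  proof (rule cInf_lower)
    have "(\<integral>x. f x - c \<partial>R) = 0" using if1 by (simp add: c_def)
    moreover have "\<forall>k\<in>{1..n}. q k \<in> Q" using q AQ by blast
    ultimately show "sqrt (\<integral>x. (f x - c)\<^sup>2 \<partial>R) \<in> {sqrt (\<integral>x. (u x - max_affine n q p x)\<^sup>2 \<partial>R) | q p.
       (\<forall>k\<in>{1..n}. q k \<in> Q) \<and> (\<integral>x. (u x - max_affine n q p x) \<partial>R) = 0}"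
      unfolding shift[symmetric] by blast
    show "bdd_below {sqrt (\<integral>x. (u x - max_affine n q p x)\<^sup>2 \<partial>R) | q p.
       (\<forall>k\<in>{1..n}. q k \<in> Q) \<and> (\<integral>x. (u x - max_affine n q p x) \<partial>R) = 0}"
      by (rule bdd_belowI[of _ 0]) auto
  qed
  also have "(\<integral>x. (f x - c)\<^sup>2 \<partial>R) \<le> 4 * r * L * c"
    unfolding c_def by (rule mean_zero_second_moment_le[OF R.prob_space_axioms if1 if2 AE_f(1)])
  also have "\<dots> \<le> 4 * r * L * (2 * r * ?W)" using c_le r(1) L(1) by (intro mult_left_mono) auto
  also have "\<dots> = 8 * r\<^sup>2 * L * ?W" by (simp add: power2_eq_square)
  finally show ?thesis by (simp add: real_sqrt_mult)
qed

lemma val_polyhedral_le_quantization: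
  assumes u: "convex_on UNIV u" and n: "1 \<le> n"
    and T: "T \<in> borel_measurable borel" "range T \<subseteq> Q" "AE x in R. T x \<in> subgradients u x"
  shows "val_polyhedral n X \<rho> Q u \<le> sqrt (8 * r\<^sup>2 * L) * sqrt (val_quantization n 1 Q (distr R borel T))"
proof -
  let ?V = "val_polyhedral n X \<rho> Q u" and ?C = "sqrt (8 * r\<^sup>2 * L)"
  let ?\<mu> = "distr R borel T"
  have C: "0 < ?C" using r L by simp
  have "0 \<le> ?V"
    unfolding val_polyhedral_eq[OF u n]
  proof (rule cInf_greatest)
    have "Q \<noteq> {}" using T(2) by auto
    then show "{sqrt (\<integral>x. (u x - max_affine n q p x)\<^sup>2 \<partial>R) | q p.
       (\<forall>k\<in>{1..n}. q k \<in> Q) \<and> (\<integral>x. (u x - max_affine n q p x) \<partial>R) = 0} \<noteq> {}"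
      using polyhedral_feasible[OF u n] by blast
  qed auto
  have "(?V / ?C)\<^sup>2 \<le> val_quantization n 1 Q ?\<mu>"
    unfolding val_quantization_def
  proof (rule cInf_greatest)
    obtain q0 where q0: "q0 \<in> Q" using T(2) by blast
    let ?N = "return borel q0 :: (real^'d) measure"
    have N: "?N \<in> prob_measures_on {q0}" "?N \<in> prob_measures_on Q"
      using q0 sets_XQ by (auto simp: prob_measures_on_def prob_space_return)
    have "measure_support ?N \<subseteq> {q0}" by (rule measure_support_subset[OF N(1)]) simp
    then have "finite (measure_support ?N)" "card (measure_support ?N) \<le> card {q0}"
      by (blast intro: finite_subset, intro card_mono) auto
    then have "card (measure_support ?N) \<le> n" using n by simp
    with N(2) \<open>finite (measure_support ?N)\<close>
    show "{wasserstein 1 ?\<mu> N | N. N \<in> prob_measures_on Q \<and> finite (measure_support N) \<and> card (measure_support N) \<le> n} \<noteq> {}"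
      by blast
    fix w assume "w \<in> {wasserstein 1 ?\<mu> N | N. N \<in> prob_measures_on Q \<and> finite (measure_support N) \<and> card (measure_support N) \<le> n}"
    then obtain N where N: "w = wasserstein 1 ?\<mu> N" "N \<in> prob_measures_on Q" "finite (measure_support N)"
      "card (measure_support N) \<le> n" by blast
    have "?V \<le> ?C * sqrt w" unfolding N(1) by (rule val_polyhedral_le_wasserstein[OF u n T N(2-4)])
    then have "?V / ?C \<le> sqrt w" using C by (simp add: divide_le_eq mult.commute)
    moreover have "0 \<le> ?V / ?C" using \<open>0 \<le> ?V\<close> C by simp
    ultimately have "(?V / ?C)\<^sup>2 \<le> (sqrt w)\<^sup>2" by (rule power_mono)
    then show "(?V / ?C)\<^sup>2 \<le> w" by (simp add: N(1) wasserstein_nonneg)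
  qed
  then have "?V / ?C \<le> sqrt (val_quantization n 1 Q ?\<mu>)" by (rule real_le_rsqrt)
  then show ?thesis using C by (simp add: divide_le_eq mult.commute)
qed

end

theorem theorem3:
  fixes X Q :: "(real^'d) set" and \<rho> :: "real^'d \<Rightarrow> real"
  assumes "compact X" and "convex X"
    and "\<rho> \<in> borel_measurable borel" and "\<And>x. 0 \<le> \<rho> x"
    and "density lborel (\<lambda>x. ennreal (\<rho> x)) \<in> prob_measures_on X"
    and "\<exists>a b. 0 < a \<and> 0 < b \<and> (AE x in lborel. x \<in> X \<longrightarrow> a \<le> \<rho> x \<and> \<rho> x \<le> b)"
    and "compact Q" and "convex Q"
  shows "\<exists>C\<^sub>L C\<^sub>R. 0 < C\<^sub>L \<and> 0 < C\<^sub>R \<and>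
    (\<forall>(n::nat) (u :: real^'d \<Rightarrow> real) \<mu>.
       n \<ge> 1 \<longrightarrow> convex_on UNIV u \<longrightarrow> closed (epigraph UNIV u) \<longrightarrow>
       \<mu> = monge_ampere (density lborel (\<lambda>x. ennreal (\<rho> x))) (legendre_fenchel u) \<longrightarrow>
       \<mu> \<in> prob_measures_on Q \<longrightarrow>
       C\<^sub>L * (val_quantization n 2 Q \<mu>) ^ 3 \<le> val_polyhedral n X \<rho> Q u \<and>
       val_polyhedral n X \<rho> Q u \<le> C\<^sub>R * sqrt (val_quantization n 1 Q \<mu>))"
proof -
  obtain a b where ab: "0 < a" "0 < b" "AE x in lborel. x \<in> X \<longrightarrow> a \<le> \<rho> x \<and> \<rho> x \<le> b"
    using assms(6) by blast
  obtain r where r: "0 < r" "\<And>x. x \<in> X \<Longrightarrow> norm x \<le> r"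
    using compact_imp_bounded[OF assms(1)] by (auto simp: bounded_pos)
  obtain L where L: "0 < L" "\<And>y. y \<in> Q \<Longrightarrow> norm y \<le> L"
    using compact_imp_bounded[OF assms(7)] by (auto simp: bounded_pos)
  interpret bounded_density X Q \<rho> a b r L
    by unfold_locales (use assms ab r L in auto)
  show ?thesis
  proof (intro exI conjI allI impI)
    show "0 < 1 / sqrt (8 * lower_const ^ 3)" using lower_const_pos by simp
    show "0 < sqrt (8 * r\<^sup>2 * L)" using r L by simp
    fix n :: nat and u :: "real^'d \<Rightarrow> real" and \<mu>
    assume n: "1 \<le> n" and u: "convex_on UNIV u"
      and \<mu>: "\<mu> = monge_ampere (density lborel (\<lambda>x. ennreal (\<rho> x))) (legendre_fenchel u)"
        "\<mu> \<in> prob_measures_on Q"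
    obtain T where T: "T \<in> borel_measurable borel" "range T \<subseteq> Q" "AE x in R. T x \<in> subgradients u x"
      and \<mu>T: "\<mu> = distr R borel T"
      using monge_ampere_eq_distr[OF u R.prob_space_axioms sets_R \<mu>[folded R_def] assms(7)] by blast
    show "1 / sqrt (8 * lower_const ^ 3) * (val_quantization n 2 Q \<mu>) ^ 3 \<le> val_polyhedral n X \<rho> Q u"
      unfolding \<mu>T by (rule val_quantization_cube_le[OF u n T])
    show "val_polyhedral n X \<rho> Q u \<le> sqrt (8 * r\<^sup>2 * L) * sqrt (val_quantization n 1 Q \<mu>)"
      unfolding \<mu>T by (rule val_polyhedral_le_quantization[OF u n T])
  qed
qed

end
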